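(* Let $E$ be a Banach lattice. Then: (i) $\text{r-l-Lwc}(E)$ is a subalgebra of $\mathrm{L}_r(E)$, and $\text{r-l-Mwc}(E)$ is a subalgebra of $\mathrm{L}_r(E)$. Moreover, $$\text{r-l-Lwc}(E)=\mathrm{L}_r(E)\iff I_E\in\text{l-Lwc}(E),$$ $$\text{r-l-Mwc}(E)=\mathrm{L}_r(E)\iff I_E\in\text{l-Mwc}(E).$$ (ii) If $E$ is Dedekind complete, then $\text{r-l-Lwc}(E)$ is a closed order ideal of the Banach lattice $(\mathrm{L}_r(E),\|\cdot\|_r)$, and $\text{r-l-Mwc}(E)$ is a closed order ideal of the Banach lattice $(\mathrm{L}_r(E),\|\cdot\|_r)$.
   Context: $\mathrm{L}(E)$ is the algebra of bounded linear operators on $E$, ordered by $S\le T$ iff $Sx\le Tx$ for all $x\ge 0$; $I_E$ is the identity operator; $\mathrm{L}_r(E)$ is the space of regular operators on $E$ (differences of two positive operators), and $\|T\|_r=\inf\{\|S\|:\pm T\le S\in\mathrm{L}(E)\}$ is the regular norm. For a subset $A$ of a Banach lattice, $\mathrm{sol}(A)=\bigcup_{a\in A}[-|a|,|a|]$; $A$ is an Lwc set if every disjoint sequence in $\mathrm{sol}(A)$ converges to $0$ in norm. A bounded subset $A$ of a Banach space $X$ is limited if every weak$^\ast$-null sequence $(f_n)$ in the dual $X'$ satisfies $\sup_{a\in A}|f_n(a)|\to 0$. $\text{l-Lwc}(E)$ is the set of $T\in\mathrm{L}(E)$ that map limited subsets of $E$ to Lwc subsets of $E$. $\text{l-Mwc}(E)$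 is the set of $T\in\mathrm{L}(E)$ such that $Tx_n\to 0$ weakly for every disjoint norm-bounded sequence $(x_n)$ in $E$. $\text{r-l-Lwc}(E)$ (respectively, $\text{r-l-Mwc}(E)$) is the set of operators of the form $T_1-T_2$, where $T_1,T_2$ are positive operators in $\text{l-Lwc}(E)$ (respectively, in $\text{l-Mwc}(E)$). *)

theory Defs
  imports "HOL-Analysis.Analysis" "HOL-Library.Lattice_Algebras"
begin

section \<open>Banach lattices\<close>

text \<open>Real Banach lattices. The modulus \<open>\<bar>x\<bar> = sup x (- x)\<close> is
  inherited from \<^class>\<open>lattice_ab_group_add_abs\<close>.\<close>

class banach_lattice = banach + ordered_real_vector + lattice_ab_group_add_abs +
  assumes norm_mono: "\<bar>x\<bar> \<le> \<bar>y\<bar> \<Longrightarrow> norm x \<le> norm y"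

instance real :: banach_lattice
  by standard (auto simp: sup_real_def)

definition sup_in :: "'v::order set \<Rightarrow> 'v set \<Rightarrow> 'v \<Rightarrow> bool"
  where "sup_in V B s \<longleftrightarrow>
    s \<in> V \<and> (\<forall>b\<in>B. b \<le> s) \<and> (\<forall>u\<in>V. (\<forall>b\<in>B. b \<le> u) \<longrightarrow> s \<le> u)"

definition dedekind_complete :: "'a::banach_lattice itself \<Rightarrow> bool"
  where "dedekind_complete _ \<longleftrightarrow>
    (\<forall>B::'a set. B \<noteq> {} \<and> bdd_above B \<longrightarrow> (\<exists>s. sup_in UNIV B s))"

definition disjoint_seq :: "(nat \<Rightarrow> 'a::banach_lattice) \<Rightarrow> bool"
  where "disjoint_seq x \<longleftrightarrow> (\<forall>m n. m \<noteq> n \<longrightarrow> inf \<bar>x m\<bar> \<bar>x n\<bar> = 0)"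

definition sol :: "'a::banach_lattice set \<Rightarrow> 'a set"
  where "sol A = (\<Union>a\<in>A. {- \<bar>a\<bar>..\<bar>a\<bar>})"

definition Lwc_set :: "'a::banach_lattice set \<Rightarrow> bool"
  where "Lwc_set A \<longleftrightarrow>
    (\<forall>x. range x \<subseteq> sol A \<and> disjoint_seq x \<longrightarrow> x \<longlonglongrightarrow> 0)"

section \<open>Limited sets and weak convergence\<close>

definition weak_star_null :: "(nat \<Rightarrow> 'a::real_normed_vector \<Rightarrow>\<^sub>L real) \<Rightarrow> bool"
  where "weak_star_null f \<longleftrightarrow> (\<forall>x. (\<lambda>n. f n x) \<longlonglongrightarrow> 0)"

definition weakly_null :: "(nat \<Rightarrow> 'a::real_normed_vector) \<Rightarrow> bool"
  where "weakly_null x \<longleftrightarrow> (\<forall>f :: 'a \<Rightarrow>\<^sub>L real. (\<lambda>n. f (x n)) \<longlonglongrightarrow> 0)"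

text \<open>The supremum is taken in \<^typ>\<open>ennreal\<close> so that it is \<open>0\<close>, and not an unspecified real,
  for \<open>A = {}\<close>.\<close>

definition limited :: "'a::real_normed_vector set \<Rightarrow> bool"
  where "limited A \<longleftrightarrow> bounded A \<and>
    (\<forall>f. weak_star_null f \<longrightarrow> (\<lambda>n. SUP a\<in>A. ennreal \<bar>blinfun_apply (f n) a\<bar>) \<longlonglongrightarrow> 0)"

section \<open>Order structure on bounded operators\<close>

lemma blinfun_eqI_nonneg:
  fixes S T :: "'a::banach_lattice \<Rightarrow>\<^sub>L 'b::real_normed_vector"
  assumes "\<And>x. 0 \<le> x \<Longrightarrow> S x = T x"
  shows "S = T"
proof (rule blinfun_eqI)
  fix x :: 'a
  have x: "x = pprt x - pprt (- x)"
    by (metis prts pprt_neg diff_minus_eq_add)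
  show "S x = T x"
    by (subst (1 2) x) (simp only: blinfun.diff_right assms zero_le_pprt)
qed

instantiation blinfun :: (banach_lattice, banach_lattice) ordered_real_vector
begin

definition less_eq_blinfun :: "'a \<Rightarrow>\<^sub>L 'b \<Rightarrow> 'a \<Rightarrow>\<^sub>L 'b \<Rightarrow> bool"
  where "S \<le> T \<longleftrightarrow> (\<forall>x\<ge>0. blinfun_apply S x \<le> blinfun_apply T x)"

definition less_blinfun :: "'a \<Rightarrow>\<^sub>L 'b \<Rightarrow> 'a \<Rightarrow>\<^sub>L 'b \<Rightarrow> bool"
  where "S < T \<longleftrightarrow> S \<le> T \<and> \<not> T \<le> (S :: 'a \<Rightarrow>\<^sub>L 'b)"

instance
proof
  fix S T U :: "'a \<Rightarrow>\<^sub>L 'b" and a b :: real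
  show "S < T \<longleftrightarrow> S \<le> T \<and> \<not> T \<le> S"
    by (rule less_blinfun_def)
  show "S \<le> S"
    by (simp add: less_eq_blinfun_def)
  show "S \<le> U" if "S \<le> T" "T \<le> U"
    using that by (auto simp: less_eq_blinfun_def intro: order_trans)
  show "S = T" if "S \<le> T" "T \<le> S"
    using that by (intro blinfun_eqI_nonneg) (auto simp: less_eq_blinfun_def intro: antisym)
  show "U + S \<le> U + T" if "S \<le> T"
    using that by (auto simp: less_eq_blinfun_def blinfun.add_left)
  show "a *\<^sub>R S \<le> a *\<^sub>R T" if "S \<le> T" "0 \<le> a"
    using that by (auto simp: less_eq_blinfun_def blinfun.scaleR_left intro: scaleR_left_mono)
  show "a *\<^sub>R S \<le> b *\<^sub>R S" if "a \<le> b" "0 \<le> S"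
    using that by (auto simp: less_eq_blinfun_def blinfun.scaleR_left intro: scaleR_right_mono)
qed

end

definition regular_ops :: "('a::banach_lattice \<Rightarrow>\<^sub>L 'a) set"
  where "regular_ops = {T1 - T2 | T1 T2. 0 \<le> T1 \<and> 0 \<le> T2}"

definition regular_norm :: "('a::banach_lattice \<Rightarrow>\<^sub>L 'a) \<Rightarrow> real"
  where "regular_norm T = Inf {norm S | S. T \<le> S \<and> - T \<le> S}"

section \<open>The operator classes\<close>

definition l_Lwc :: "('a::banach_lattice \<Rightarrow>\<^sub>L 'a) set"
  where "l_Lwc = {T. \<forall>A. limited A \<longrightarrow> Lwc_set (blinfun_apply T ` A)}"

definition l_Mwc :: "('a::banach_lattice \<Rightarrow>\<^sub>L 'a) set"
  where "l_Mwc = {T. \<forall>x. disjoint_seq x \<and> bounded (range x) \<longrightarrow> weakly_null (\<lambda>n. blinfun_apply T (x n))}"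

definition r_l_Lwc :: "('a::banach_lattice \<Rightarrow>\<^sub>L 'a) set"
  where "r_l_Lwc = {T1 - T2 | T1 T2. 0 \<le> T1 \<and> T1 \<in> l_Lwc \<and> 0 \<le> T2 \<and> T2 \<in> l_Lwc}"

definition r_l_Mwc :: "('a::banach_lattice \<Rightarrow>\<^sub>L 'a) set"
  where "r_l_Mwc = {T1 - T2 | T1 T2. 0 \<le> T1 \<and> T1 \<in> l_Mwc \<and> 0 \<le> T2 \<and> T2 \<in> l_Mwc}"

section \<open>Subalgebras, Banach lattices on a carrier, closed order ideals\<close>

text \<open>Subalgebras need not contain the identity operator.\<close>

definition subalgebra_of ::
    "('a::real_normed_vector \<Rightarrow>\<^sub>L 'a) set \<Rightarrow> ('a \<Rightarrow>\<^sub>L 'a) set \<Rightarrow> bool"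
  where "subalgebra_of A L \<longleftrightarrow>
    A \<subseteq> L \<and> subspace A \<and> (\<forall>S\<in>A. \<forall>T\<in>A. S o\<^sub>L T \<in> A)"

text \<open>The regular operators form a set, normed by a norm other than that of the ambient type,
  so the class \<^class>\<open>banach_lattice\<close> does not apply to them; the following are its relative
  versions for a subset \<open>V\<close> of an ordered vector space and a norm \<open>N\<close> on \<open>V\<close>.
  Suprema are taken in \<open>V\<close>.\<close>

definition modulus_in :: "'v::ordered_real_vector set \<Rightarrow> 'v \<Rightarrow> 'v"
  where "modulus_in V x = (THE m. sup_in V {x, - x} m)"

definition banach_lattice_on :: "'v::ordered_real_vector set \<Rightarrow> ('v \<Rightarrow> real) \<Rightarrow> bool"
  where "banach_lattice_on V N \<longleftrightarrow>
    subspace V \<and>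
    (\<forall>x\<in>V. \<forall>y\<in>V. \<exists>s. sup_in V {x, y} s) \<and>
    (\<forall>x\<in>V. 0 \<le> N x \<and> (N x = 0 \<longleftrightarrow> x = 0)) \<and>
    (\<forall>x\<in>V. \<forall>a. N (a *\<^sub>R x) = \<bar>a\<bar> * N x) \<and>
    (\<forall>x\<in>V. \<forall>y\<in>V. N (x + y) \<le> N x + N y) \<and>
    (\<forall>x\<in>V. \<forall>y\<in>V. modulus_in V x \<le> modulus_in V y \<longrightarrow> N x \<le> N y) \<and>
    (\<forall>X. range X \<subseteq> V \<and> (\<forall>e>0. \<exists>M. \<forall>m\<ge>M. \<forall>n\<ge>M. N (X m - X n) < e) \<longrightarrow>
      (\<exists>x\<in>V. (\<lambda>n. N (X n - x)) \<longlonglongrightarrow> 0))"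

definition order_ideal_in :: "'v::ordered_real_vector set \<Rightarrow> 'v set \<Rightarrow> bool"
  where "order_ideal_in V A \<longleftrightarrow>
    A \<subseteq> V \<and> subspace A \<and>
    (\<forall>x\<in>V. \<forall>y\<in>A. modulus_in V x \<le> modulus_in V y \<longrightarrow> x \<in> A)"

definition closed_wrt :: "'v::real_vector set \<Rightarrow> ('v \<Rightarrow> real) \<Rightarrow> 'v set \<Rightarrow> bool"
  where "closed_wrt V N A \<longleftrightarrow>
    (\<forall>X. \<forall>x\<in>V. range X \<subseteq> A \<and> (\<lambda>n. N (X n - x)) \<longlonglongrightarrow> 0 \<longrightarrow> x \<in> A)"

definition closed_order_ideal :: "'v::ordered_real_vector set \<Rightarrow> ('v \<Rightarrow> real) \<Rightarrow> 'v set \<Rightarrow> bool"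
  where "closed_order_ideal V N A \<longleftrightarrow> order_ideal_in V A \<and> closed_wrt V N A"

end

theory Submission
  imports Defs
begin

text \<open>An operator \<open>T\<close> lies in l-Lwc iff every disjoint sequence in every order interval
  \<open>[-\<bar>T x\<bar>, \<bar>T x\<bar>]\<close> is norm null, that is, iff the range of \<open>T\<close> lies in the order continuous
  part of the lattice, which is a closed ideal. With this description, both l-Lwc and l-Mwc are
  visibly norm closed subspaces of operators with the domination property: if
  \<open>0 \<le> S \<le> T\<close> and \<open>T\<close> is in the class, so is \<open>S\<close>. For such a class \<open>C\<close>, the differences
  of positive members are exactly the operators \<open>T\<close> with \<open>\<plusminus>T \<le> S\<close> for some \<open>S \<in> C\<close>. In the
  Dedekind complete case this means \<open>\<bar>T\<bar> \<in> C\<close>, and the ideal property and closedness follow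
  because the modulus is continuous from the regular norm to the operator norm.\<close>

section \<open>Elementary facts on Banach lattices\<close>

text \<open>The hard half of the description of l-Lwc is the passage from points to limited sets.
  Limitedness is tested on weak-star null functionals, so a disjoint sequence \<open>x n\<close>
  below \<open>\<bar>T (a n)\<bar>\<close> has to produce functionals that are large at
  \<open>T (a n)\<close> and yet tend to 0 at each \<open>T y\<close>. Projections onto the bands of
  the \<open>x n\<close> would give them, but need not exist. Sublinear functions bounded by the
  norm take their place, and Hahn-Banach supplies supporting functionals. Domination in l-Mwc meets
  another obstacle: the functionals that test weak convergence have no sign. They are majorized by
  positive ones through the Riesz-Kantorovich construction with real values, where the completeness
  in question is that of the reals. Each class also absorbs arbitrary operators by composition on
  one side, members of l-Lwc standing as left factors and members of l-Mwc as right factors. This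
  gives both the subalgebras and the criteria on the identity.\<close>

lemma norm_abs_eq [simp]: "norm \<bar>x\<bar> = norm (x :: 'a::banach_lattice)"
  by (intro antisym norm_mono) simp_all

lemma norm_le_of_abs_le:
  fixes x y :: "'a::banach_lattice"
  assumes "\<bar>x\<bar> \<le> y"
  shows "norm x \<le> norm y"
proof -
  have "0 \<le> y"
    using abs_ge_zero assms by (rule order_trans)
  then show ?thesis
    using assms by (intro norm_mono) simp
qed

lemma abs_le_iff_lattice:
  fixes x y :: "'a::lattice_ab_group_add_abs"
  shows "\<bar>x\<bar> \<le> y \<longleftrightarrow> x \<le> y \<and> - x \<le> y"
  by (auto intro: abs_leI dest: abs_le_D1 abs_le_D2)

lemma scaleR_inf:
  fixes x y :: "'a::banach_lattice"
  assumes "0 < c"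
  shows "c *\<^sub>R inf x y = inf (c *\<^sub>R x) (c *\<^sub>R y)"
proof (rule antisym)
  show "c *\<^sub>R inf x y \<le> inf (c *\<^sub>R x) (c *\<^sub>R y)"
    using assms by (simp add: scaleR_left_mono)
  have "inverse c *\<^sub>R inf (c *\<^sub>R x) (c *\<^sub>R y) \<le> inf x y"
  proof (rule le_infI)
    have "inverse c *\<^sub>R inf (c *\<^sub>R x) (c *\<^sub>R y) \<le> inverse c *\<^sub>R (c *\<^sub>R x)"
      using assms by (intro scaleR_left_mono) auto
    then show "inverse c *\<^sub>R inf (c *\<^sub>R x) (c *\<^sub>R y) \<le> x"
      using assms by simp
    have "inverse c *\<^sub>R inf (c *\<^sub>R x) (c *\<^sub>R y) \<le> inverse c *\<^sub>R (c *\<^sub>R y)"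
      using assms by (intro scaleR_left_mono) auto
    then show "inverse c *\<^sub>R inf (c *\<^sub>R x) (c *\<^sub>R y) \<le> y"
      using assms by simp
  qed
  then have "c *\<^sub>R (inverse c *\<^sub>R inf (c *\<^sub>R x) (c *\<^sub>R y)) \<le> c *\<^sub>R inf x y"
    using assms by (intro scaleR_left_mono) auto
  then show "inf (c *\<^sub>R x) (c *\<^sub>R y) \<le> c *\<^sub>R inf x y"
    using assms by simp
qed

lemma abs_scaleR_lattice:
  fixes x :: "'a::banach_lattice"
  shows "\<bar>c *\<^sub>R x\<bar> = \<bar>c\<bar> *\<^sub>R \<bar>x\<bar>"
proof -
  have le: "\<bar>d *\<^sub>R y\<bar> \<le> \<bar>d\<bar> *\<^sub>R \<bar>y\<bar>" for d and y :: 'a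
  proof (cases "0 \<le> d")
    case True
    then show ?thesis
      by (auto simp: abs_le_iff_lattice abs_ge_self abs_ge_minus_self
          simp flip: scaleR_minus_right intro!: scaleR_left_mono)
  next
    case False
    then have "(- d) *\<^sub>R (- y) \<le> (- d) *\<^sub>R \<bar>y\<bar>" "(- d) *\<^sub>R y \<le> (- d) *\<^sub>R \<bar>y\<bar>"
      by (intro scaleR_left_mono; simp add: abs_ge_self abs_ge_minus_self)+
    then show ?thesis
      using False by (auto simp: abs_le_iff_lattice)
  qed
  show ?thesis
  proof (cases "c = 0")
    case False
    have "\<bar>x\<bar> \<le> \<bar>inverse c\<bar> *\<^sub>R \<bar>c *\<^sub>R x\<bar>"
      using le[of "inverse c" "c *\<^sub>R x"] False by simp
    then have "\<bar>c\<bar> *\<^sub>R \<bar>x\<bar> \<le> \<bar>c\<bar> *\<^sub>R (\<bar>inverse c\<bar> *\<^sub>R \<bar>c *\<^sub>R x\<bar>)"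
      by (intro scaleR_left_mono) auto
    then have "\<bar>c\<bar> *\<^sub>R \<bar>x\<bar> \<le> \<bar>c *\<^sub>R x\<bar>"
      using False by (simp flip: abs_mult)
    with le show ?thesis
      by (intro antisym)
  qed simp
qed

text \<open>The witness \<open>inf z a\<close> leaves a remainder below \<open>b\<close>, because
  \<open>z - b\<close> lies below both \<open>z\<close> and \<open>a\<close>.\<close>

lemma riesz_decomposition:
  fixes a b z :: "'a::lattice_ab_group_add"
  assumes "0 \<le> z" "z \<le> a + b" "0 \<le> a" "0 \<le> b"
  obtains u v where "z = u + v" "0 \<le> u" "u \<le> a" "0 \<le> v" "v \<le> b"
proof
  show "z = inf z a + (z - inf z a)"
    by (metis add.commute diff_add_cancel)
  have "z - b \<le> inf z a"
    using assms by (auto simp: algebra_simps)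
  then show "z - inf z a \<le> b"
    by (metis add.commute diff_le_eq)
  show "0 \<le> z - inf z a"
    by (simp only: diff_ge_0_iff_ge inf_le1)
qed (use assms in auto)

text \<open>Riesz decomposition splits \<open>inf (a + b) c\<close> into parts below
  \<open>a\<close> and \<open>b\<close>; being positive with sum below \<open>c\<close>, both parts
  are below \<open>c\<close> as well.\<close>

lemma inf_add_le:
  fixes a b c :: "'a::lattice_ab_group_add"
  assumes "0 \<le> a" "0 \<le> b" "0 \<le> c"
  shows "inf (a + b) c \<le> inf a c + inf b c"
proof -
  have "0 \<le> inf (a + b) c" "inf (a + b) c \<le> a + b"
    using assms by auto
  then obtain u v where uv: "inf (a + b) c = u + v" "0 \<le> u" "u \<le> a" "0 \<le> v" "v \<le> b"
    using assms riesz_decomposition by metis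
  have "u + v \<le> c"
    by (simp flip: uv(1))
  then have "u \<le> c" "v \<le> c"
    using uv by (meson add_increasing add_increasing2 order_refl order_trans)+
  then show ?thesis
    using uv by (auto intro: add_mono)
qed

lemma pos_diff:
  fixes x :: "'a::lattice_ab_group_add"
  obtains a b where "x = a - b" "0 \<le> a" "0 \<le> b"
  using prts[of x] nprt_le_zero[of x] zero_le_pprt[of x]
  by (metis add_0 diff_minus_eq_add neg_0_le_iff_le)

text \<open>The negative part \<open>pprt (- l)\<close> of the limit is at most
  \<open>\<bar>x n - l\<bar>\<close>, whose norm tends to 0; so it vanishes.\<close>

lemma nonneg_limit:
  fixes x :: "nat \<Rightarrow> 'a::banach_lattice"
  assumes "x \<longlonglongrightarrow> l" "\<And>n. 0 \<le> x n"
  shows "0 \<le> l"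
proof -
  have "norm (pprt (- l)) \<le> norm (x n - l)" for n
  proof -
    have "- l \<le> x n - l"
      using assms(2)[of n] by simp
    also have "\<dots> \<le> \<bar>x n - l\<bar>"
      by (rule abs_ge_self)
    finally have "- l \<le> \<bar>x n - l\<bar>" .
    then have "pprt (- l) \<le> \<bar>x n - l\<bar>"
      unfolding pprt_def by simp
    then have "norm (pprt (- l)) \<le> norm \<bar>x n - l\<bar>"
      by (intro norm_le_of_abs_le) simp
    then show ?thesis
      by simp
  qed
  moreover have "(\<lambda>n. norm (x n - l)) \<longlonglongrightarrow> 0"
    using assms(1) by (simp add: LIM_zero tendsto_norm_zero)
  ultimately have "norm (pprt (- l)) \<le> 0"
    by (intro LIMSEQ_le_const) auto
  then have "pprt (- l) = 0"
    by simp
  then show ?thesis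
    by (metis le_zero_iff_zero_pprt neg_le_0_iff_le)
qed

section \<open>The Hahn-Banach theorem for sublinear functionals\<close>

text \<open>Homogeneity is required as one inequality for positive scalars, which is easier to
  check; scaling back by the inverse yields the equality in \<open>sublinear_scaleR\<close>.\<close>

definition sublinear :: "('a::real_vector \<Rightarrow> real) \<Rightarrow> bool"
  where "sublinear p \<longleftrightarrow>
    (\<forall>x y. p (x + y) \<le> p x + p y) \<and> (\<forall>c>0. \<forall>x. p (c *\<^sub>R x) \<le> c * p x)"

lemma sublinear_scaleR:
  assumes "sublinear p" "0 \<le> c"
  shows "p (c *\<^sub>R x) = c * p x"
proof (cases "c = 0")
  case True
  have "p (d *\<^sub>R 0) \<le> d * p 0" if "0 < d" for d
    using assms(1) that unfolding sublinear_def by blast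
  \<comment> \<open>\<open>p 0 \<le> 2 * p 0\<close> and \<open>p 0 \<le> p 0 / 2\<close> force
    \<open>p 0 = 0\<close>.\<close>
  from this[of 2] this[of "1 / 2"] show ?thesis
    using True by simp
next
  case False
  have "p (d *\<^sub>R y) \<le> d * p y" if "0 < d" for d y
    using assms(1) that unfolding sublinear_def by blast
  from this[of "inverse c" "c *\<^sub>R x"] this[of c x] show ?thesis
    using assms False by (auto simp: field_simps)
qed

lemma sublinear_zero [simp]: "sublinear p \<Longrightarrow> p 0 = 0"
  using sublinear_scaleR[of p 0 0] by simp

lemma sublinear_minus:
  assumes "sublinear p"
  shows "- p (- x) \<le> p x"
proof -
  have "p (x + - x) \<le> p x + p (- x)"
    using assms unfolding sublinear_def by blast
  then show ?thesis
    using assms by simp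
qed

text \<open>Taking the infimum of \<open>p (x + t *\<^sub>R z) - t * p z\<close> over
  \<open>t \<ge> 0\<close> lowers \<open>p\<close> until it is linear along \<open>z\<close>: the
  value at \<open>t = 0\<close> gives \<open>q \<le> p\<close>, and \<open>t = 1\<close> at
  \<open>- z\<close> gives the new bound.\<close>

lemma sublinear_refine:
  assumes p: "sublinear p"
  obtains q where "sublinear q" "q \<le> p" "q (- z) \<le> - p z"
proof
  define F where "F x t = p (x + t *\<^sub>R z) - t * p z" for x t
  define q where "q x = (INF t\<in>{0..}. F x t)" for x
  have lower: "- p (- x) \<le> F x t" if "0 \<le> t" for x t
  proof -
    have "p (t *\<^sub>R z) \<le> p (x + t *\<^sub>R z) + p (- x)"
      using p unfolding sublinear_def by (metis add.commute minus_add_cancel)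
    then show ?thesis
      using sublinear_scaleR[OF p that, of z] by (simp add: F_def)
  qed
  have bdd: "bdd_below (F x ` {0..})" for x
    using lower by (intro bdd_belowI2[where m = "- p (- x)"]) auto
  have q_le: "q x \<le> F x t" if "0 \<le> t" for x t
    unfolding q_def using bdd that by (intro cINF_lower) auto
  have le_q: "c \<le> q x" if "\<And>t. 0 \<le> t \<Longrightarrow> c \<le> F x t" for c x
    unfolding q_def using that by (intro cINF_greatest) auto
  show "q \<le> p"
    using q_le[of 0] by (auto simp: le_fun_def F_def)
  show "q (- z) \<le> - p z"
    using q_le[of 1 "- z"] p by (simp add: F_def)
  show "sublinear q"
    unfolding sublinear_def
  proof safe
    fix x y
    have *: "q (x + y) \<le> F x t + F y s" if "0 \<le> t" "0 \<le> s" for t s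
    proof -
      have "p (x + t *\<^sub>R z + (y + s *\<^sub>R z)) \<le> p (x + t *\<^sub>R z) + p (y + s *\<^sub>R z)"
        using p unfolding sublinear_def by blast
      then have "F (x + y) (t + s) \<le> F x t + F y s"
        by (simp add: F_def algebra_simps)
      then show ?thesis
        using q_le[of "t + s" "x + y"] that by simp
    qed
    have "q (x + y) - F y s \<le> q x" if "0 \<le> s" for s
      using *[OF _ that] by (intro le_q) (simp add: algebra_simps)
    then have "q (x + y) - q x \<le> q y"
      by (intro le_q) (simp add: algebra_simps)
    then show "q (x + y) \<le> q x + q y"
      by simp
  next
    fix c :: real and x
    assume c: "0 < c"
    have "q (c *\<^sub>R x) / c \<le> q x"
    proof (rule le_q)
      fix t :: real
      assume t: "0 \<le> t"
      have "p (c *\<^sub>R (x + t *\<^sub>R z)) = c * p (x + t *\<^sub>R z)"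
        using c by (intro sublinear_scaleR[OF p]) simp
      then have "F (c *\<^sub>R x) (c * t) = c * F x t"
        by (simp add: F_def algebra_simps)
      then show "q (c *\<^sub>R x) / c \<le> F x t"
        using q_le[of "c * t" "c *\<^sub>R x"] c t by (simp add: field_simps)
    qed
    then show "q (c *\<^sub>R x) \<le> c * q x"
      using c by (simp add: field_simps)
  qed
qed

text \<open>All members lie below \<open>p\<close>, hence above \<open>- p (- x)\<close> at
  \<open>x\<close>, so the pointwise infimum is finite. Its subadditivity needs the chain condition:
  of two members, the smaller one serves at both points.\<close>

lemma sublinear_chain_Inf:
  assumes sub: "\<And>q. q \<in> C \<Longrightarrow> sublinear q \<and> q \<le> p"
    and chain: "\<And>q r. q \<in> C \<Longrightarrow> r \<in> C \<Longrightarrow> q \<le> r \<or> r \<le> q"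
    and ne: "C \<noteq> {}"
  obtains u where "sublinear u" "\<And>q. q \<in> C \<Longrightarrow> u \<le> q"
proof
  define u where "u x = (INF q\<in>C. q x)" for x
  have "- p (- x) \<le> q x" if "q \<in> C" for q x
  proof -
    have "q (- x) \<le> p (- x)" "- q (- x) \<le> q x"
      using sub[OF that] sublinear_minus[of q x] by (auto simp: le_fun_def)
    then show ?thesis by simp
  qed
  then have bdd: "bdd_below ((\<lambda>q. q x) ` C)" for x
    by (intro bdd_belowI2[where m = "- p (- x)"])
  have u_le: "u x \<le> q x" if "q \<in> C" for q x
    unfolding u_def using bdd that by (intro cINF_lower)
  have le_u: "c \<le> u x" if "\<And>q. q \<in> C \<Longrightarrow> c \<le> q x" for c x
    unfolding u_def using that ne by (intro cINF_greatest) auto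
  show "u \<le> q" if "q \<in> C" for q
    using u_le[OF that] by (simp add: le_fun_def)
  show "sublinear u"
    unfolding sublinear_def
  proof safe
    fix x y
    have *: "u (x + y) \<le> q x + r y" if q: "q \<in> C" and r: "r \<in> C" for q r
    proof -
      have "q (x + y) \<le> q x + q y" "r (x + y) \<le> r x + r y"
        using sub q r unfolding sublinear_def by auto
      moreover have "u (x + y) \<le> q (x + y)" "u (x + y) \<le> r (x + y)"
        using u_le q r by auto
      moreover consider "q \<le> r" | "r \<le> q"
        using chain q r by blast
      then have "q y \<le> r y \<or> r x \<le> q x"
        by cases (auto simp: le_fun_def)
      ultimately show ?thesis
        by linarith
    qed
    have "u (x + y) - r y \<le> u x" if "r \<in> C" for r
      using *[OF _ that] by (intro le_u) (simp add: algebra_simps)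
    then have "u (x + y) - u x \<le> u y"
      by (intro le_u) (simp add: algebra_simps)
    then show "u (x + y) \<le> u x + u y"
      by simp
  next
    fix c :: real and x
    assume c: "0 < c"
    have "u (c *\<^sub>R x) / c \<le> u x"
    proof (rule le_u)
      fix q
      assume q: "q \<in> C"
      then have "q (c *\<^sub>R x) \<le> c * q x"
        using sub c unfolding sublinear_def by blast
      then show "u (c *\<^sub>R x) / c \<le> q x"
        using u_le[OF q, of "c *\<^sub>R x"] c by (simp add: field_simps)
    qed
    then show "u (c *\<^sub>R x) \<le> c * u x"
      using c by (simp add: field_simps)
  qed
qed

text \<open>Refining \<open>q\<close> along \<open>x\<close> cannot change it, which makes
  \<open>q\<close> odd; an odd subadditive function is additive.\<close>

lemma minimal_sublinear_linear:
  assumes q: "sublinear q" and min: "\<And>r. sublinear r \<Longrightarrow> r \<le> q \<Longrightarrow> r = q"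
  shows "linear q"
proof -
  have odd: "q (- x) = - q x" for x
  proof -
    obtain r where "sublinear r" "r \<le> q" "r (- x) \<le> - q x"
      using sublinear_refine[OF q] by blast
    then have "q (- x) \<le> - q x"
      using min by blast
    then show ?thesis
      using sublinear_minus[OF q, of x] by simp
  qed
  have sub: "q (x + y) \<le> q x + q y" for x y
    using q unfolding sublinear_def by blast
  show ?thesis
  proof (rule linearI)
    fix x y
    show "q (x + y) = q x + q y"
      using sub[of x y] sub[of "- x" "- y"] odd[of "x + y"] odd[of x] odd[of y] by simp
  next
    fix c :: real and x
    show "q (c *\<^sub>R x) = c *\<^sub>R q x"
    proof (cases "0 \<le> c")
      case True
      then show ?thesis
        using sublinear_scaleR[OF q] by simp
    next
      case False
      then have "q ((- c) *\<^sub>R x) = - c * q x"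
        by (intro sublinear_scaleR[OF q]) simp
      then show ?thesis
        using odd[of "c *\<^sub>R x"] by simp
    qed
  qed
qed

lemma hahn_banach_sublinear:
  assumes p: "sublinear p"
  obtains f where "linear f" "\<And>x. f x \<le> p x" "f z = p z"
proof -
  \<comment> \<open>Refining at \<open>z\<close> in advance secures \<open>f z = p z\<close>: every
    function below \<open>p'\<close> is at most \<open>- p z\<close> at \<open>- z\<close>.\<close>
  obtain p' where p': "sublinear p'" "p' \<le> p" "p' (- z) \<le> - p z"
    using sublinear_refine[OF p] by blast
  define A where "A = {q. sublinear q \<and> q \<le> p'}"
  have "\<exists>m\<in>A. \<forall>a\<in>A. a \<le> m \<longrightarrow> a = m"
  proof (rule predicate_Zorn)
    \<comment> \<open>The order is reversed, so that the element produced by Zorn's lemma is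
      minimal.\<close>
    show "partial_order_on A (relation_of (\<lambda>x y. y \<le> x) A)"
      by (rule partial_order_on_relation_ofI) auto
    fix C
    assume "C \<in> Chains (relation_of (\<lambda>x y. y \<le> x) A)"
    then have C: "\<And>q r. q \<in> C \<Longrightarrow> r \<in> C \<Longrightarrow> (r \<le> q \<or> q \<le> r) \<and> q \<in> A"
      by (auto simp: Chains_def relation_of_def)
    show "\<exists>u\<in>A. \<forall>a\<in>C. u \<le> a"
    proof (cases "C = {}")
      case True
      then show ?thesis
        using p' by (auto simp: A_def)
    next
      case False
      obtain u where u: "sublinear u" "\<And>q. q \<in> C \<Longrightarrow> u \<le> q"
        using sublinear_chain_Inf[of C p'] C False by (auto simp: A_def)
      moreover have "u \<le> p'"
        using u False C by (auto simp: A_def intro: order_trans)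
      ultimately show ?thesis
        by (auto simp: A_def)
    qed
  qed
  then obtain f where f: "f \<in> A" "\<And>a. a \<in> A \<Longrightarrow> a \<le> f \<Longrightarrow> a = f"
    by blast
  show ?thesis
  proof
    show lin: "linear f"
      using f by (intro minimal_sublinear_linear) (auto simp: A_def)
    show f_le: "f x \<le> p x" for x
      using f(1) p'(2) by (auto simp: A_def le_fun_def intro: order_trans)
    have "f (- z) \<le> - p z"
      using f(1) p'(3) by (auto simp: A_def le_fun_def intro: order_trans)
    then show "f z = p z"
      using f_le[of z] linear_neg[OF lin, of z] by simp
  qed
qed

section \<open>The order continuous part\<close>

lemma disjoint_seq_mono:
  assumes "disjoint_seq x" "\<And>n. \<bar>y n\<bar> \<le> \<bar>x n\<bar>"
  shows "disjoint_seq y"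
  unfolding disjoint_seq_def
proof (intro allI impI)
  fix m n :: nat
  assume "m \<noteq> n"
  then have "inf \<bar>x m\<bar> \<bar>x n\<bar> = 0"
    using assms(1) by (simp add: disjoint_seq_def)
  moreover have "inf \<bar>y m\<bar> \<bar>y n\<bar> \<le> inf \<bar>x m\<bar> \<bar>x n\<bar>"
    using assms(2) by (intro inf_mono)
  ultimately show "inf \<bar>y m\<bar> \<bar>y n\<bar> = 0"
    by (intro antisym) auto
qed

lemma mem_sol_iff: "z \<in> sol A \<longleftrightarrow> (\<exists>a\<in>A. \<bar>z\<bar> \<le> \<bar>a\<bar>)"
  unfolding sol_def by (auto simp: abs_le_iff_lattice minus_le_iff)

lemma Lwc_set_singleton_iff:
  "Lwc_set {x} \<longleftrightarrow> (\<forall>z. (\<forall>n. \<bar>z n\<bar> \<le> \<bar>x\<bar>) \<and> disjoint_seq z \<longrightarrow> z \<longlonglongrightarrow> 0)"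
  unfolding Lwc_set_def by (auto simp: mem_sol_iff image_subset_iff)

lemma Lwc_set_singleton_mono: "Lwc_set {y} \<Longrightarrow> \<bar>x\<bar> \<le> \<bar>y\<bar> \<Longrightarrow> Lwc_set {x}"
  unfolding Lwc_set_singleton_iff by (meson order_trans)

text \<open>Riesz decomposition splits \<open>\<bar>z n\<bar>\<close> along
  \<open>\<bar>y\<bar> + \<bar>w\<bar>\<close>. The first part stays disjoint, hence is null, and
  the second has small norm. This is the closedness of the order continuous part.\<close>

lemma Lwc_set_singleton_approx:
  fixes x :: "'a::banach_lattice"
  assumes "\<And>e. e > 0 \<Longrightarrow> \<exists>y w. Lwc_set {y} \<and> \<bar>x\<bar> \<le> \<bar>y\<bar> + \<bar>w\<bar> \<and> norm w < e"
  shows "Lwc_set {x}"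
  unfolding Lwc_set_singleton_iff
proof safe
  fix z :: "nat \<Rightarrow> 'a"
  assume z: "\<forall>n. \<bar>z n\<bar> \<le> \<bar>x\<bar>" "disjoint_seq z"
  show "z \<longlonglongrightarrow> 0"
  proof (rule LIMSEQ_I)
    fix e :: real
    assume "0 < e"
    then obtain y w where yw: "Lwc_set {y}" "\<bar>x\<bar> \<le> \<bar>y\<bar> + \<bar>w\<bar>" "norm w < e / 2"
      using assms[of "e / 2"] by auto
    have "\<exists>u v. \<bar>z n\<bar> = u + v \<and> 0 \<le> u \<and> u \<le> \<bar>y\<bar> \<and> 0 \<le> v \<and> v \<le> \<bar>w\<bar>" for n
    proof -
      have "\<bar>z n\<bar> \<le> \<bar>y\<bar> + \<bar>w\<bar>"
        using yw(2) z(1) by (blast intro: order_trans)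
      then show ?thesis
        by (rule riesz_decomposition[rotated]) (simp, simp, blast, simp)
    qed
    then obtain u v where uv: "\<And>n. \<bar>z n\<bar> = u n + v n" "\<And>n. 0 \<le> u n" "\<And>n. u n \<le> \<bar>y\<bar>"
        "\<And>n. 0 \<le> v n" "\<And>n. v n \<le> \<bar>w\<bar>"
      by metis
    have "disjoint_seq u"
      using z(2) by (rule disjoint_seq_mono) (simp add: uv)
    then have "u \<longlonglongrightarrow> 0"
      using yw(1) uv unfolding Lwc_set_singleton_iff by auto
    then have "\<exists>N. \<forall>n\<ge>N. norm (u n - 0) < e / 2"
      by (rule LIMSEQ_D) (use \<open>0 < e\<close> in simp)
    then obtain N where N: "\<And>n. n \<ge> N \<Longrightarrow> norm (u n) < e / 2"
      by auto
    have "norm (z n) < e" if "n \<ge> N" for n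
    proof -
      have "norm (z n) = norm (u n + v n)"
        by (simp flip: uv(1))
      also have "\<dots> \<le> norm (u n) + norm (v n)"
        by (rule norm_triangle_ineq)
      also have "norm (v n) \<le> norm \<bar>w\<bar>"
        using uv by (intro norm_le_of_abs_le) simp
      finally show ?thesis
        using N[OF that] yw(3) by simp
    qed
    then show "\<exists>N. \<forall>n\<ge>N. norm (z n - 0) < e"
      by auto
  qed
qed

text \<open>Both parts of a Riesz splitting lie below \<open>\<bar>z n\<bar>\<close> and inherit its
  disjointness, so each of them is null.\<close>

lemma Lwc_set_singleton_add:
  fixes x y :: "'a::banach_lattice"
  assumes "Lwc_set {x}" "Lwc_set {y}"
  shows "Lwc_set {x + y}"
  unfolding Lwc_set_singleton_iff
proof safe
  fix z :: "nat \<Rightarrow> 'a"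
  assume z: "\<forall>n. \<bar>z n\<bar> \<le> \<bar>x + y\<bar>" "disjoint_seq z"
  have "\<exists>u v. \<bar>z n\<bar> = u + v \<and> 0 \<le> u \<and> u \<le> \<bar>x\<bar> \<and> 0 \<le> v \<and> v \<le> \<bar>y\<bar>" for n
  proof -
    have "\<bar>z n\<bar> \<le> \<bar>x\<bar> + \<bar>y\<bar>"
      using abs_triangle_ineq z(1) by (blast intro: order_trans)
    then show ?thesis
      by (rule riesz_decomposition[rotated]) (simp, simp, blast, simp)
  qed
  then obtain u v where uv: "\<And>n. \<bar>z n\<bar> = u n + v n" "\<And>n. 0 \<le> u n" "\<And>n. u n \<le> \<bar>x\<bar>"
      "\<And>n. 0 \<le> v n" "\<And>n. v n \<le> \<bar>y\<bar>"
    by metis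
  have "disjoint_seq u" "disjoint_seq v"
    using z(2) by (rule disjoint_seq_mono; simp add: uv)+
  then have "u \<longlonglongrightarrow> 0" "v \<longlonglongrightarrow> 0"
    using assms uv unfolding Lwc_set_singleton_iff by auto
  then have "(\<lambda>n. \<bar>z n\<bar>) \<longlonglongrightarrow> 0"
    using tendsto_add[of u 0 sequentially v 0] by (simp add: uv(1))
  then show "z \<longlonglongrightarrow> 0"
    using tendsto_norm_zero_iff[of z] tendsto_norm_zero_iff[of "\<lambda>n. \<bar>z n\<bar>"] by simp
qed

lemma Lwc_set_singleton_0: "Lwc_set {0 :: 'a::banach_lattice}"
proof -
  have "z = (\<lambda>n. 0)" if "\<forall>n. \<bar>z n\<bar> \<le> \<bar>0\<bar>" for z :: "nat \<Rightarrow> 'a"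
    using that by (intro ext) (metis abs_ge_zero abs_0_eq abs_zero antisym)
  then show ?thesis
    unfolding Lwc_set_singleton_iff by blast
qed

lemma Lwc_set_singleton_scaleR:
  fixes x :: "'a::banach_lattice"
  assumes "Lwc_set {x}"
  shows "Lwc_set {c *\<^sub>R x}"
proof (cases "c = 0")
  case True
  then show ?thesis
    by (simp add: Lwc_set_singleton_0)
next
  case False
  show ?thesis
    unfolding Lwc_set_singleton_iff
  proof safe
    fix z :: "nat \<Rightarrow> 'a"
    assume z: "\<forall>n. \<bar>z n\<bar> \<le> \<bar>c *\<^sub>R x\<bar>" "disjoint_seq z"
    define w where "w n = inverse c *\<^sub>R z n" for n
    have "\<bar>w n\<bar> \<le> \<bar>x\<bar>" for n
    proof -
      have "\<bar>inverse c\<bar> *\<^sub>R \<bar>z n\<bar> \<le> \<bar>inverse c\<bar> *\<^sub>R (\<bar>c\<bar> *\<^sub>R \<bar>x\<bar>)"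
        using z(1) by (intro scaleR_left_mono) (auto simp: abs_scaleR_lattice)
      then show ?thesis
        using False by (simp add: w_def abs_scaleR_lattice)
    qed
    moreover have "disjoint_seq w"
      unfolding disjoint_seq_def
    proof (intro allI impI)
      fix m n :: nat
      assume "m \<noteq> n"
      then show "inf \<bar>w m\<bar> \<bar>w n\<bar> = 0"
        using z(2) False scaleR_inf[of "\<bar>inverse c\<bar>" "\<bar>z m\<bar>" "\<bar>z n\<bar>"]
        by (simp add: w_def abs_scaleR_lattice disjoint_seq_def)
    qed
    ultimately have "w \<longlonglongrightarrow> 0"
      using assms unfolding Lwc_set_singleton_iff by blast
    then have "(\<lambda>n. c *\<^sub>R w n) \<longlonglongrightarrow> c *\<^sub>R 0"
      by (intro tendsto_intros)
    then show "z \<longlonglongrightarrow> 0"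
      using False by (simp add: w_def)
  qed
qed

section \<open>Operators mapping limited sets to Lwc sets\<close>

text \<open>A substitute, available without band projections, for the norm of the component of \<open>y\<close> in
  the band generated by \<open>x\<close>.\<close>

definition band_seminorm :: "'a::banach_lattice \<Rightarrow> 'a \<Rightarrow> real"
  where "band_seminorm x y = (SUP k\<in>{0..}. norm (inf \<bar>y\<bar> (k *\<^sub>R \<bar>x\<bar>)))"

lemma norm_inf_le:
  fixes x y :: "'a::banach_lattice"
  assumes "0 \<le> x"
  shows "norm (inf \<bar>y\<bar> x) \<le> norm y"
  using assms norm_le_of_abs_le[of "inf \<bar>y\<bar> x" "\<bar>y\<bar>"] by simp

lemma norm_inf_le_band_seminorm:
  assumes "0 \<le> k"
  shows "norm (inf \<bar>y\<bar> (k *\<^sub>R \<bar>x\<bar>)) \<le> band_seminorm x y"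
  unfolding band_seminorm_def using assms
  by (intro cSUP_upper bdd_aboveI2[where M = "norm y"]) (auto intro!: norm_inf_le scaleR_nonneg_nonneg)

lemma band_seminorm_le:
  assumes "\<And>k. 0 \<le> k \<Longrightarrow> norm (inf \<bar>y\<bar> (k *\<^sub>R \<bar>x\<bar>)) \<le> c"
  shows "band_seminorm x y \<le> c"
  unfolding band_seminorm_def using assms by (intro cSUP_least) auto

lemma band_seminorm_le_norm: "band_seminorm x y \<le> norm y"
  by (intro band_seminorm_le norm_inf_le scaleR_nonneg_nonneg) auto

lemma band_seminorm_minus [simp]: "band_seminorm x (- y) = band_seminorm x y"
  by (simp add: band_seminorm_def)

lemma norm_le_band_seminorm:
  assumes "\<bar>x\<bar> \<le> \<bar>y\<bar>"
  shows "norm x \<le> band_seminorm x y"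
proof -
  have "inf \<bar>y\<bar> \<bar>x\<bar> = \<bar>x\<bar>"
    using assms by (simp add: inf_absorb2)
  then show ?thesis
    using norm_inf_le_band_seminorm[of 1 y x] by simp
qed

text \<open>Subadditivity is \<open>inf_add_le\<close> for a common \<open>k\<close>. Homogeneity
  relies on the supremum over all multiples, since scaling \<open>y\<close> by \<open>c\<close>
  replaces \<open>k\<close> by \<open>k / c\<close>.\<close>

lemma sublinear_band_seminorm: "sublinear (band_seminorm (x :: 'a::banach_lattice))"
  unfolding sublinear_def
proof safe
  fix y z :: 'a
  show "band_seminorm x (y + z) \<le> band_seminorm x y + band_seminorm x z"
  proof (rule band_seminorm_le)
    fix k :: real
    assume k: "0 \<le> k"
    then have pos: "0 \<le> k *\<^sub>R \<bar>x\<bar>"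
      by (simp add: scaleR_nonneg_nonneg)
    have "inf \<bar>y + z\<bar> (k *\<^sub>R \<bar>x\<bar>) \<le> inf (\<bar>y\<bar> + \<bar>z\<bar>) (k *\<^sub>R \<bar>x\<bar>)"
      by (intro inf_mono abs_triangle_ineq order_refl)
    also have "\<dots> \<le> inf \<bar>y\<bar> (k *\<^sub>R \<bar>x\<bar>) + inf \<bar>z\<bar> (k *\<^sub>R \<bar>x\<bar>)"
      using pos by (intro inf_add_le) auto
    finally have "norm (inf \<bar>y + z\<bar> (k *\<^sub>R \<bar>x\<bar>))
        \<le> norm (inf \<bar>y\<bar> (k *\<^sub>R \<bar>x\<bar>) + inf \<bar>z\<bar> (k *\<^sub>R \<bar>x\<bar>))"
      using pos by (intro norm_le_of_abs_le) simp
    also have "\<dots> \<le> norm (inf \<bar>y\<bar> (k *\<^sub>R \<bar>x\<bar>)) + norm (inf \<bar>z\<bar> (k *\<^sub>R \<bar>x\<bar>))"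
      by (rule norm_triangle_ineq)
    also have "\<dots> \<le> band_seminorm x y + band_seminorm x z"
      using k by (intro add_mono norm_inf_le_band_seminorm)
    finally show "norm (inf \<bar>y + z\<bar> (k *\<^sub>R \<bar>x\<bar>)) \<le> band_seminorm x y + band_seminorm x z" .
  qed
next
  fix c :: real and y :: 'a
  assume c: "0 < c"
  show "band_seminorm x (c *\<^sub>R y) \<le> c * band_seminorm x y"
  proof (rule band_seminorm_le)
    fix k :: real
    assume k: "0 \<le> k"
    have "inf \<bar>c *\<^sub>R y\<bar> (k *\<^sub>R \<bar>x\<bar>) = c *\<^sub>R inf \<bar>y\<bar> ((k / c) *\<^sub>R \<bar>x\<bar>)"
      using c by (simp add: scaleR_inf abs_scaleR_lattice)
    then show "norm (inf \<bar>c *\<^sub>R y\<bar> (k *\<^sub>R \<bar>x\<bar>)) \<le> c * band_seminorm x y"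
      using c k norm_inf_le_band_seminorm[of "k / c" y x] by simp
  qed
qed

text \<open>Nearly optimal multiples \<open>k n\<close> turn the suprema into norms of elements
  \<open>w n\<close> below \<open>\<bar>y\<bar>\<close>. These are disjoint, each \<open>w n\<close>
  being below a multiple of \<open>\<bar>x n\<bar>\<close>, so the condition on \<open>y\<close>
  applies to them.\<close>

lemma band_seminorm_tendsto_0:
  fixes x :: "nat \<Rightarrow> 'a::banach_lattice"
  assumes x: "disjoint_seq x" and y: "Lwc_set {y}"
  shows "(\<lambda>n. band_seminorm (x n) y) \<longlonglongrightarrow> 0"
proof -
  \<comment> \<open>The supremum need not be attained; the permitted error \<open>1 / Suc n\<close>
    tends to 0.\<close>
  have "\<exists>k\<ge>0. band_seminorm (x n) y < norm (inf \<bar>y\<bar> (k *\<^sub>R \<bar>x n\<bar>)) + 1 / Suc n" for n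
  proof (rule ccontr)
    assume "\<not> ?thesis"
    then have "band_seminorm (x n) y \<le> band_seminorm (x n) y - 1 / Suc n"
      by (intro band_seminorm_le) (force simp: not_less)
    then show False
      by simp
  qed
  then obtain k where k: "\<And>n. 0 \<le> k n"
      "\<And>n. band_seminorm (x n) y < norm (inf \<bar>y\<bar> (k n *\<^sub>R \<bar>x n\<bar>)) + 1 / Suc n"
    by metis
  define w where "w n = inf \<bar>y\<bar> (k n *\<^sub>R \<bar>x n\<bar>)" for n
  have w: "0 \<le> w n" "w n \<le> \<bar>y\<bar>" "w n \<le> k n *\<^sub>R \<bar>x n\<bar>" for n
    using k(1)[of n] by (auto simp: w_def scaleR_nonneg_nonneg)
  have "disjoint_seq w"
    unfolding disjoint_seq_def
  proof (intro allI impI)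
    fix m n :: nat
    assume mn: "m \<noteq> n"
    \<comment> \<open>A common multiplier for both terms lets \<open>scaleR_inf\<close> pull it out
      of the infimum; the added 1 makes it positive.\<close>
    define c where "c = k m + k n + 1"
    have c: "0 < c" "k m \<le> c" "k n \<le> c"
      using k(1)[of m] k(1)[of n] by (auto simp: c_def)
    have "k m *\<^sub>R \<bar>x m\<bar> \<le> c *\<^sub>R \<bar>x m\<bar>" "k n *\<^sub>R \<bar>x n\<bar> \<le> c *\<^sub>R \<bar>x n\<bar>"
      using c by (intro scaleR_right_mono; simp)+
    then have "inf (w m) (w n) \<le> inf (c *\<^sub>R \<bar>x m\<bar>) (c *\<^sub>R \<bar>x n\<bar>)"
      using w by (meson inf_mono order_trans)
    also have "\<dots> = 0"
      using x mn c by (simp add: disjoint_seq_def flip: scaleR_inf)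
    finally have "inf (w m) (w n) = 0"
      using w by (intro antisym) auto
    then show "inf \<bar>w m\<bar> \<bar>w n\<bar> = 0"
      using w by simp
  qed
  then have "w \<longlonglongrightarrow> 0"
    using y w unfolding Lwc_set_singleton_iff by auto
  then have "(\<lambda>n. norm (w n) + 1 / Suc n) \<longlonglongrightarrow> 0 + 0"
    by (intro tendsto_add tendsto_norm_zero LIMSEQ_Suc[OF lim_1_over_n])
  then have lim: "(\<lambda>n. norm (w n) + 1 / Suc n) \<longlonglongrightarrow> 0"
    by simp
  show ?thesis
  proof (rule tendsto_sandwich[OF _ _ tendsto_const lim])
    show "\<forall>\<^sub>F n in sequentially. 0 \<le> band_seminorm (x n) y"
      using norm_inf_le_band_seminorm[OF k(1)] norm_ge_zero order_trans
      by (intro always_eventually) blast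
    show "\<forall>\<^sub>F n in sequentially. band_seminorm (x n) y \<le> norm (w n) + 1 / Suc n"
      using k(2) by (intro always_eventually) (auto simp: w_def less_imp_le)
  qed
qed

text \<open>Hahn-Banach at \<open>z\<close>. The seminorm is even, so the one-sided bound controls
  \<open>\<bar>f y\<bar>\<close>; it is at most the norm, so \<open>f\<close> is bounded.\<close>

lemma band_seminorm_support:
  fixes x z :: "'a::banach_lattice"
  obtains f :: "'a \<Rightarrow>\<^sub>L real"
    where "f z = band_seminorm x z" "\<And>y. \<bar>f y\<bar> \<le> band_seminorm x y"
proof -
  obtain f where f: "linear f" "\<And>y. f y \<le> band_seminorm x y" "f z = band_seminorm x z"
    using hahn_banach_sublinear[OF sublinear_band_seminorm] by blast
  have abs: "\<bar>f y\<bar> \<le> band_seminorm x y" for y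
    using f(2)[of y] f(2)[of "- y"] linear_neg[OF f(1), of y] by simp
  have "bounded_linear f"
  proof (rule bounded_linear_intro[where K = 1])
    show "norm (f y) \<le> norm y * 1" for y
      using abs[of y] band_seminorm_le_norm[of x y] by simp
  qed (use f(1) in \<open>auto simp: linear_add linear_scale\<close>)
  then show ?thesis
    using that[of "Blinfun f"] f abs by (simp add: bounded_linear_Blinfun_apply)
qed

section \<open>Limited sets and the pointwise description of l-Lwc\<close>

lemma limited_singleton: "limited {x}"
  unfolding limited_def weak_star_null_def
proof safe
  fix f :: "nat \<Rightarrow> 'a \<Rightarrow>\<^sub>L real"
  assume "\<forall>x. (\<lambda>n. f n x) \<longlonglongrightarrow> 0"
  then have "(\<lambda>n. ennreal \<bar>f n x\<bar>) \<longlonglongrightarrow> ennreal 0"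
    by (intro tendsto_ennrealI tendsto_rabs_zero) blast
  then show "(\<lambda>n. SUP a\<in>{x}. ennreal \<bar>f n a\<bar>) \<longlonglongrightarrow> 0"
    by simp
qed auto

lemma limited_seq_tendsto_0:
  assumes "limited A" "weak_star_null f" "\<And>n. a n \<in> A"
  shows "(\<lambda>n. f n (a n)) \<longlonglongrightarrow> 0"
proof -
  have sup: "(\<lambda>n. SUP a\<in>A. ennreal \<bar>f n a\<bar>) \<longlonglongrightarrow> 0"
    using assms unfolding limited_def by blast
  have "(\<lambda>n. ennreal \<bar>f n (a n)\<bar>) \<longlonglongrightarrow> 0"
    by (rule tendsto_sandwich[OF _ _ tendsto_const sup])
      (auto intro!: always_eventually SUP_upper assms)
  then have "(\<lambda>n. ennreal \<bar>f n (a n)\<bar>) \<longlonglongrightarrow> ennreal 0"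
    by simp
  then have "(\<lambda>n. \<bar>f n (a n)\<bar>) \<longlonglongrightarrow> 0"
    by (subst (asm) tendsto_ennreal_iff) auto
  then show ?thesis
    by (rule tendsto_rabs_zero_cancel)
qed

text \<open>Given a disjoint sequence \<open>x n\<close> with \<open>\<bar>x n\<bar> \<le> \<bar>T (a n)\<bar>\<close>, the functionals attaining
  \<open>band_seminorm (x n)\<close> at \<open>T (a n)\<close> become weak-star null after composition with \<open>T\<close>, so
  limitedness of the set of all \<open>a n\<close> applies to them.\<close>

lemma l_Lwc_iff: "T \<in> l_Lwc \<longleftrightarrow> (\<forall>x. Lwc_set {blinfun_apply T x})"
proof
  assume "T \<in> l_Lwc"
  then have "Lwc_set (blinfun_apply T ` {x})" for x
    using limited_singleton[of x] unfolding l_Lwc_def by blast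
  then show "\<forall>x. Lwc_set {blinfun_apply T x}"
    by simp
next
  assume T: "\<forall>x. Lwc_set {blinfun_apply T x}"
  have "Lwc_set (blinfun_apply T ` A)" if A: "limited A" for A
    unfolding Lwc_set_def
  proof safe
    fix x :: "nat \<Rightarrow> 'a"
    assume x: "range x \<subseteq> sol (blinfun_apply T ` A)" "disjoint_seq x"
    then have "\<forall>n. \<exists>a\<in>A. \<bar>x n\<bar> \<le> \<bar>T a\<bar>"
      by (auto simp: mem_sol_iff image_subset_iff)
    then obtain a where a: "\<And>n. a n \<in> A" "\<And>n. \<bar>x n\<bar> \<le> \<bar>T (a n)\<bar>"
      by metis
    have "\<exists>f :: 'a \<Rightarrow>\<^sub>L real. f (T (a n)) = band_seminorm (x n) (T (a n))
        \<and> (\<forall>y. \<bar>f y\<bar> \<le> band_seminorm (x n) y)" for n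
      using band_seminorm_support by metis
    then obtain f :: "nat \<Rightarrow> 'a \<Rightarrow>\<^sub>L real"
      where f: "\<And>n. f n (T (a n)) = band_seminorm (x n) (T (a n))"
        "\<And>n y. \<bar>f n y\<bar> \<le> band_seminorm (x n) y"
      by metis
    have "weak_star_null (\<lambda>n. f n o\<^sub>L T)"
      unfolding weak_star_null_def
    proof
      fix y
      show "(\<lambda>n. (f n o\<^sub>L T) y) \<longlonglongrightarrow> 0"
        by (rule Lim_null_comparison[OF _ band_seminorm_tendsto_0[OF x(2), of "T y"]])
          (use f(2) T in \<open>auto intro: always_eventually\<close>)
    qed
    then have "(\<lambda>n. (f n o\<^sub>L T) (a n)) \<longlonglongrightarrow> 0"
      using A a(1) by (intro limited_seq_tendsto_0)
    then have "(\<lambda>n. band_seminorm (x n) (T (a n))) \<longlonglongrightarrow> 0"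
      by (simp add: f(1))
    then show "x \<longlonglongrightarrow> 0"
      by (rule Lim_null_comparison[OF always_eventually, rotated])
        (use a(2) norm_le_band_seminorm in blast)
  qed
  then show "T \<in> l_Lwc"
    unfolding l_Lwc_def by blast
qed

section \<open>Positive operators and the Riesz-Kantorovich theorem\<close>

lemma blinfun_le_iff: "S \<le> T \<longleftrightarrow> (\<forall>x\<ge>0. blinfun_apply S x \<le> blinfun_apply T x)"
  by (rule less_eq_blinfun_def)

lemma blinfun_nonneg_iff: "0 \<le> T \<longleftrightarrow> (\<forall>x\<ge>0. 0 \<le> blinfun_apply T x)"
  by (simp add: blinfun_le_iff)

lemma blinfun_compose_nonneg:
  assumes "0 \<le> S" "0 \<le> T"
  shows "0 \<le> S o\<^sub>L T"
  using assms by (simp add: blinfun_nonneg_iff)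

text \<open>Each of the two dominations is used on one part of \<open>x = pprt x + nprt x\<close>:
  \<open>T \<le> S\<close> at \<open>pprt x\<close> and \<open>- T \<le> S\<close> at
  \<open>- nprt x\<close>.\<close>

lemma abs_blinfun_apply_le:
  fixes S T :: "'a::banach_lattice \<Rightarrow>\<^sub>L 'b::banach_lattice"
  assumes "T \<le> S" "- T \<le> S"
  shows "\<bar>T x\<bar> \<le> S \<bar>x\<bar>"
proof -
  have *: "U x \<le> S \<bar>x\<bar>" if "U \<le> S" "- U \<le> S" for U
  proof -
    have "U (pprt x) \<le> S (pprt x)"
      using that(1) by (simp add: blinfun_le_iff)
    moreover have "(- U) (- nprt x) \<le> S (- nprt x)"
      using that(2) unfolding blinfun_le_iff by simp
    then have "U (nprt x) \<le> - S (nprt x)"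
      by (simp add: blinfun.minus_left blinfun.minus_right)
    ultimately have "U (pprt x) + U (nprt x) \<le> S (pprt x) + - S (nprt x)"
      by (rule add_mono)
    also have "U (pprt x) + U (nprt x) = U x"
      by (metis blinfun.add_right prts)
    also have "S (pprt x) + - S (nprt x) = S \<bar>x\<bar>"
      by (simp add: abs_prts blinfun.diff_right)
    finally show ?thesis .
  qed
  show ?thesis
    using *[of T] *[of "- T"] assms by (auto simp: abs_le_iff_lattice blinfun.minus_left)
qed

lemma norm_blinfun_le_of_dominated:
  fixes S T :: "'a::banach_lattice \<Rightarrow>\<^sub>L 'b::banach_lattice"
  assumes "T \<le> S" "- T \<le> S"
  shows "norm T \<le> norm S"
proof (rule norm_blinfun_bound)
  fix x
  have "norm (T x) \<le> norm (S \<bar>x\<bar>)"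
    using abs_blinfun_apply_le[OF assms] by (rule norm_le_of_abs_le)
  also have "\<dots> \<le> norm S * norm x"
    using norm_blinfun[of S "\<bar>x\<bar>"] by simp
  finally show "norm (T x) \<le> norm S * norm x" .
qed simp

lemma blinfun_le_limit:
  fixes S T :: "nat \<Rightarrow> 'a::banach_lattice \<Rightarrow>\<^sub>L 'b::banach_lattice"
  assumes "S \<longlonglongrightarrow> A" "T \<longlonglongrightarrow> B" "\<And>n. S n \<le> T n"
  shows "A \<le> B"
  unfolding blinfun_le_iff
proof safe
  fix x :: 'a
  assume x: "0 \<le> x"
  have "(\<lambda>n. T n x - S n x) \<longlonglongrightarrow> B x - A x"
    using assms(1,2) by (intro tendsto_intros)
  then have "0 \<le> B x - A x"
    using assms(3) x by (rule_tac nonneg_limit) (auto simp: blinfun_le_iff)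
  then show "A x \<le> B x"
    by simp
qed

lemma nonneg_of_minus_le:
  fixes S T :: "'a::ordered_real_vector"
  assumes "T \<le> S" "- T \<le> S"
  shows "0 \<le> S"
proof -
  have "T + - T \<le> S + S"
    using assms by (rule add_mono)
  then have "0 \<le> (1 / 2) *\<^sub>R (S + S)"
    by (intro scaleR_nonneg_nonneg) auto
  then show ?thesis
    by (simp only: scaleR_half_double)
qed

text \<open>Kantorovich's extension: by additivity \<open>r a - r b\<close> depends only on
  \<open>a - b\<close>, so it defines an operator on all differences of positive elements.\<close>

lemma additive_on_cone_extend:
  fixes r :: "'a::banach_lattice \<Rightarrow> 'b::real_normed_vector"
  assumes add: "\<And>x y. 0 \<le> x \<Longrightarrow> 0 \<le> y \<Longrightarrow> r (x + y) = r x + r y"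
    and scale: "\<And>c x. 0 < c \<Longrightarrow> 0 \<le> x \<Longrightarrow> r (c *\<^sub>R x) = c *\<^sub>R r x"
    and bound: "\<And>x. 0 \<le> x \<Longrightarrow> norm (r x) \<le> K * norm x"
  obtains R :: "'a \<Rightarrow>\<^sub>L 'b" where "\<And>x. 0 \<le> x \<Longrightarrow> R x = r x"
proof
  define R where "R x = r (pprt x) - r (- nprt x)" for x
  have R_diff: "R (a - b) = r a - r b" if ab: "0 \<le> a" "0 \<le> b" for a b
  proof -
    have "pprt (a - b) + b = a + - nprt (a - b)"
      using prts[of "a - b"] by (simp add: algebra_simps)
    then have "r (pprt (a - b) + b) = r (a + - nprt (a - b))"
      by (rule arg_cong)
    moreover have "r (pprt (a - b) + b) = r (pprt (a - b)) + r b"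
      using ab by (intro add) auto
    moreover have "r (a + - nprt (a - b)) = r a + r (- nprt (a - b))"
      using ab by (intro add) auto
    ultimately show ?thesis
      by (simp add: R_def algebra_simps)
  qed
  have r0: "r 0 = 0"
    using add[of 0 0] by simp
  have "R (x + y) = R x + R y" for x y
  proof -
    obtain a b c d where x: "x = a - b" "0 \<le> a" "0 \<le> b" and y: "y = c - d" "0 \<le> c" "0 \<le> d"
      using pos_diff by metis
    have "R (x + y) = R ((a + c) - (b + d))"
      by (simp add: x y algebra_simps)
    also have "\<dots> = r (a + c) - r (b + d)"
      using x y by (intro R_diff) auto
    also have "\<dots> = R x + R y"
      using x y by (simp add: add R_diff)
    finally show ?thesis .
  qed
  moreover have "R (c *\<^sub>R x) = c *\<^sub>R R x" for c x
  proof -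
    obtain a b where x: "x = a - b" "0 \<le> a" "0 \<le> b"
      using pos_diff by metis
    consider "0 < c" | "c = 0" | "c < 0"
      by linarith
    then show ?thesis
    proof cases
      case 1
      then have "R (c *\<^sub>R a - c *\<^sub>R b) = r (c *\<^sub>R a) - r (c *\<^sub>R b)"
        using x by (intro R_diff scaleR_nonneg_nonneg) auto
      then show ?thesis
        using 1 x by (simp add: scale R_diff scaleR_diff_right)
    next
      case 2
      then show ?thesis
        using R_diff[of 0 0] by simp
    next
      case 3
      then have "R ((- c) *\<^sub>R b - (- c) *\<^sub>R a) = r ((- c) *\<^sub>R b) - r ((- c) *\<^sub>R a)"
        using x by (intro R_diff scaleR_nonneg_nonneg) auto
      also have "\<dots> = (- c) *\<^sub>R r b - (- c) *\<^sub>R r a"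
        using 3 x scale[of "- c"] by simp
      also have "\<dots> = c *\<^sub>R R x"
        using x by (simp add: R_diff scaleR_diff_right)
      also have "(- c) *\<^sub>R b - (- c) *\<^sub>R a = c *\<^sub>R x"
        using x by (simp add: scaleR_diff_right)
      finally show ?thesis .
    qed
  qed
  \<comment> \<open>One \<open>\<bar>K\<bar>\<close> for each of the two parts of \<open>x\<close>;
    the absolute value is there because \<open>K\<close> has no assumed sign.\<close>
  moreover have "norm (R x) \<le> norm x * (2 * \<bar>K\<bar>)" for x
  proof -
    have le: "norm (r y) \<le> \<bar>K\<bar> * norm x" if "0 \<le> y" "y \<le> \<bar>x\<bar>" for y
    proof -
      have "norm y \<le> norm \<bar>x\<bar>"
        using that by (intro norm_le_of_abs_le) simp
      then have "K * norm y \<le> \<bar>K\<bar> * norm x"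
        by (intro mult_mono) auto
      then show ?thesis
        using bound[OF that(1)] by simp
    qed
    have "pprt x \<le> \<bar>x\<bar>" "- nprt x \<le> \<bar>x\<bar>"
      by (simp_all add: abs_prts)
    then have "norm (r (pprt x)) \<le> \<bar>K\<bar> * norm x" "norm (r (- nprt x)) \<le> \<bar>K\<bar> * norm x"
      using le by auto
    then show ?thesis
      unfolding R_def using norm_triangle_ineq4[of "r (pprt x)" "r (- nprt x)"]
      by (simp add: algebra_simps)
  qed
  ultimately have "bounded_linear R"
    by (rule bounded_linear_intro)
  moreover have "R x = r x" if "0 \<le> x" for x
    using that r0 by (simp add: R_def)
  ultimately show "Blinfun R x = r x" if "0 \<le> x" for x
    using that by (simp add: bounded_linear_Blinfun_apply)
qed

text \<open>On the cone the positive part is \<open>r x\<close>, the supremum of \<open>T\<close>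
  over \<open>{0..x}\<close>, and Riesz decomposition makes \<open>r\<close> additive. The bound is
  phrased through a majorant \<open>u\<close> of controlled norm so as to cover both operators below
  a positive one and arbitrary real functionals; it also makes the extension bounded.\<close>

lemma riesz_kantorovich:
  fixes T :: "'a::banach_lattice \<Rightarrow>\<^sub>L 'b::banach_lattice"
  assumes dc: "dedekind_complete TYPE('b)"
    and bound: "\<And>x. 0 \<le> x \<Longrightarrow> \<exists>u. (\<forall>y. 0 \<le> y \<and> y \<le> x \<longrightarrow> T y \<le> u) \<and> norm u \<le> K * norm x"
  obtains P where "0 \<le> P" "T \<le> P" "\<And>S. 0 \<le> S \<Longrightarrow> T \<le> S \<Longrightarrow> P \<le> S"
proof -
  have "\<exists>s. sup_in UNIV (blinfun_apply T ` {0..x}) s" if x: "0 \<le> x" for x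
  proof -
    obtain u where "\<forall>y. 0 \<le> y \<and> y \<le> x \<longrightarrow> T y \<le> u"
      using bound[OF x] by blast
    then have "bdd_above (blinfun_apply T ` {0..x})"
      by (intro bdd_aboveI2) auto
    then show ?thesis
      using dc x unfolding dedekind_complete_def by auto
  qed
  then obtain r where "\<And>x. 0 \<le> x \<Longrightarrow> sup_in UNIV (blinfun_apply T ` {0..x}) (r x)"
    by metis
  then have upper: "\<And>x y. 0 \<le> y \<Longrightarrow> y \<le> x \<Longrightarrow> T y \<le> r x"
    and least: "\<And>x u. 0 \<le> x \<Longrightarrow> (\<And>y. 0 \<le> y \<Longrightarrow> y \<le> x \<Longrightarrow> T y \<le> u) \<Longrightarrow> r x \<le> u"
    unfolding sup_in_def by (force dest: order_trans)+
  have nonneg: "0 \<le> r x" if "0 \<le> x" for x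
    using upper[of 0 x] that by simp
  have add: "r (x + y) = r x + r y" if xy: "0 \<le> x" "0 \<le> y" for x y
  proof (rule antisym)
    show "r (x + y) \<le> r x + r y"
    proof (rule least)
      fix z
      assume "0 \<le> z" "z \<le> x + y"
      then obtain u v where "z = u + v" "0 \<le> u" "u \<le> x" "0 \<le> v" "v \<le> y"
        using riesz_decomposition[of z x y] xy by metis
      then show "T z \<le> r x + r y"
        using upper by (simp add: blinfun.add_right add_mono)
    qed (use xy in simp)
    have *: "T u + T v \<le> r (x + y)" if "0 \<le> u" "u \<le> x" "0 \<le> v" "v \<le> y" for u v
      using upper[of "u + v" "x + y"] that by (simp add: blinfun.add_right add_mono)
    \<comment> \<open>The supremum is taken in one variable at a time, first over \<open>u\<close>
      and then over \<open>v\<close>.\<close>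
    have "r x \<le> r (x + y) - T v" if "0 \<le> v" "v \<le> y" for v
      using *[OF _ _ that] xy by (intro least) (auto simp: le_diff_eq)
    then have "T v \<le> r (x + y) - r x" if "0 \<le> v" "v \<le> y" for v
      using that by (metis le_diff_eq add.commute)
    then have "r y \<le> r (x + y) - r x"
      using xy by (intro least)
    then show "r x + r y \<le> r (x + y)"
      by (metis le_diff_eq add.commute)
  qed
  have scale_le: "r (c *\<^sub>R x) \<le> c *\<^sub>R r x" if "0 < c" "0 \<le> x" for c x
  proof (rule least)
    fix y
    assume y: "0 \<le> y" "y \<le> c *\<^sub>R x"
    have "inverse c *\<^sub>R y \<le> inverse c *\<^sub>R c *\<^sub>R x"
      using y that by (intro scaleR_left_mono) auto
    then have "T (inverse c *\<^sub>R y) \<le> r x"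
      using y that by (intro upper) (auto intro!: scaleR_nonneg_nonneg)
    then have "c *\<^sub>R T (inverse c *\<^sub>R y) \<le> c *\<^sub>R r x"
      using that by (intro scaleR_left_mono) auto
    then show "T y \<le> c *\<^sub>R r x"
      using that by (simp add: blinfun.scaleR_right)
  qed (use that in \<open>auto intro: scaleR_nonneg_nonneg\<close>)
  have scale: "r (c *\<^sub>R x) = c *\<^sub>R r x" if "0 < c" "0 \<le> x" for c x
  proof (rule antisym[OF scale_le])
    have "c *\<^sub>R r (inverse c *\<^sub>R c *\<^sub>R x) \<le> c *\<^sub>R inverse c *\<^sub>R r (c *\<^sub>R x)"
      using that by (intro scaleR_left_mono scale_le scaleR_nonneg_nonneg) auto
    then show "c *\<^sub>R r x \<le> r (c *\<^sub>R x)"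
      using that by simp
  qed (use that in auto)
  have "norm (r x) \<le> K * norm x" if x: "0 \<le> x" for x
  proof -
    obtain u where u: "\<forall>y. 0 \<le> y \<and> y \<le> x \<longrightarrow> T y \<le> u" "norm u \<le> K * norm x"
      using bound[OF x] by blast
    then have "r x \<le> u"
      using x by (intro least) auto
    then have "norm (r x) \<le> norm u"
      using nonneg[OF x] by (intro norm_le_of_abs_le) simp
    then show ?thesis
      using u(2) by simp
  qed
  then obtain P :: "'a \<Rightarrow>\<^sub>L 'b" where P: "\<And>x. 0 \<le> x \<Longrightarrow> P x = r x"
    using additive_on_cone_extend[of r K] add scale by blast
  show ?thesis
  proof
    show "0 \<le> P"
      using P nonneg by (simp add: blinfun_nonneg_iff)
    show "T \<le> P"
      using P upper by (simp add: blinfun_le_iff)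
    fix S :: "'a \<Rightarrow>\<^sub>L 'b"
    assume S: "0 \<le> S" "T \<le> S"
    have "r x \<le> S x" if x: "0 \<le> x" for x
    proof (rule least[OF x])
      fix y
      assume y: "0 \<le> y" "y \<le> x"
      have "S y + 0 \<le> S y + S (x - y)"
        using S(1) y by (intro add_left_mono) (simp add: blinfun_nonneg_iff)
      then have "S y \<le> S x"
        by (simp flip: blinfun.add_right)
      moreover have "T y \<le> S y"
        using S(2) y by (simp add: blinfun_le_iff)
      ultimately show "T y \<le> S x"
        by simp
    qed
    then show "P \<le> S"
      using P by (simp add: blinfun_le_iff)
  qed
qed

section \<open>Positive parts of operators and positive majorants of functionals\<close>

lemma positive_part_exists:
  fixes T :: "'a::banach_lattice \<Rightarrow>\<^sub>L 'b::banach_lattice"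
  assumes dc: "dedekind_complete TYPE('b)" and S: "T \<le> S" "0 \<le> S"
  obtains P where "0 \<le> P" "T \<le> P" "\<And>U. 0 \<le> U \<Longrightarrow> T \<le> U \<Longrightarrow> P \<le> U"
proof -
  have "\<exists>u. (\<forall>y. 0 \<le> y \<and> y \<le> x \<longrightarrow> T y \<le> u) \<and> norm u \<le> norm S * norm x" if "0 \<le> x" for x
  proof (intro exI[of _ "S x"] conjI allI impI norm_blinfun)
    fix y
    assume y: "0 \<le> y \<and> y \<le> x"
    have "S y + 0 \<le> S y + S (x - y)"
      using S y by (intro add_left_mono) (simp add: blinfun_nonneg_iff)
    then have "S y \<le> S x"
      by (simp flip: blinfun.add_right)
    moreover have "T y \<le> S y"
      using S y by (simp add: blinfun_le_iff)
    ultimately show "T y \<le> S x"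
      by simp
  qed
  then show ?thesis
    by (rule riesz_kantorovich[OF dc]) (assumption, rule that)
qed

lemma dedekind_complete_real: "dedekind_complete TYPE(real)"
  unfolding dedekind_complete_def sup_in_def by (meson UNIV_I cSup_upper cSup_least)

text \<open>For real values the number \<open>norm g * norm x\<close> is the majorant demanded by
  \<open>riesz_kantorovich\<close>. So \<open>f\<close> and \<open>- f\<close> lie below positive
  functionals, whose sum dominates both.\<close>

lemma functional_dominated:
  fixes f :: "'a::banach_lattice \<Rightarrow>\<^sub>L real"
  obtains h where "f \<le> h" "- f \<le> h"
proof -
  have *: "\<exists>P\<ge>0. g \<le> P" for g :: "'a \<Rightarrow>\<^sub>L real"
  proof -
    have "\<exists>u. (\<forall>y. 0 \<le> y \<and> y \<le> x \<longrightarrow> g y \<le> u) \<and> norm u \<le> norm g * norm x" for x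
    proof (intro exI[of _ "norm g * norm x"] conjI allI impI)
      fix y
      assume y: "0 \<le> y \<and> y \<le> x"
      have "g y \<le> norm g * norm y"
        using norm_blinfun[of g y] by simp
      also have "\<dots> \<le> norm g * norm x"
        using y by (intro mult_left_mono norm_le_of_abs_le) auto
      finally show "g y \<le> norm g * norm x" .
    qed simp
    then obtain P where "0 \<le> P" "g \<le> P"
      by (rule riesz_kantorovich[OF dedekind_complete_real])
    then show ?thesis
      by blast
  qed
  obtain P Q where "0 \<le> P" "f \<le> P" "0 \<le> Q" "- f \<le> Q"
    using *[of f] *[of "- f"] by blast
  then have "f \<le> P + Q" "- f \<le> P + Q"
    by (auto intro: add_increasing add_increasing2)
  then show ?thesis
    by (rule that)
qed

section \<open>Regular parts of operator classes\<close>

text \<open>The common shape of \<open>r_l_Lwc\<close>, \<open>r_l_Mwc\<close> and, for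
  \<open>C = UNIV\<close>, \<open>regular_ops\<close>.\<close>

definition regular_part :: "('a::banach_lattice \<Rightarrow>\<^sub>L 'a) set \<Rightarrow> ('a \<Rightarrow>\<^sub>L 'a) set"
  where "regular_part C = {T1 - T2 | T1 T2. 0 \<le> T1 \<and> T1 \<in> C \<and> 0 \<le> T2 \<and> T2 \<in> C}"

lemma regular_partI: "0 \<le> S \<Longrightarrow> S \<in> C \<Longrightarrow> 0 \<le> T \<Longrightarrow> T \<in> C \<Longrightarrow> S - T \<in> regular_part C"
  unfolding regular_part_def by blast

lemma regular_ops_eq: "regular_ops = regular_part UNIV"
  by (simp add: regular_ops_def regular_part_def)

lemma subspace_regular_part:
  assumes C: "subspace C"
  shows "subspace (regular_part C)"
proof (rule subspaceI)
  show "0 \<in> regular_part C"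
    using regular_partI[of 0 C 0] C by (simp add: subspace_0)
  fix S T
  assume "S \<in> regular_part C" "T \<in> regular_part C"
  then obtain S1 S2 T1 T2 where S: "S = S1 - S2" "0 \<le> S1" "S1 \<in> C" "0 \<le> S2" "S2 \<in> C"
    and T: "T = T1 - T2" "0 \<le> T1" "T1 \<in> C" "0 \<le> T2" "T2 \<in> C"
    unfolding regular_part_def by blast
  have "(S1 + T1) - (S2 + T2) \<in> regular_part C"
    using S T C by (intro regular_partI) (auto intro: subspace_add)
  then show "S + T \<in> regular_part C"
    by (simp add: S T algebra_simps)
next
  fix c :: real and S
  assume "S \<in> regular_part C"
  then obtain S1 S2 where S: "S = S1 - S2" "0 \<le> S1" "S1 \<in> C" "0 \<le> S2" "S2 \<in> C"
    unfolding regular_part_def by blast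
  show "c *\<^sub>R S \<in> regular_part C"
  proof (cases "0 \<le> c")
    case True
    then have "c *\<^sub>R S1 - c *\<^sub>R S2 \<in> regular_part C"
      using S C by (intro regular_partI scaleR_nonneg_nonneg) (auto intro: subspace_scale)
    then show ?thesis
      by (simp add: S scaleR_diff_right)
  next
    case False
    then have "(- c) *\<^sub>R S2 - (- c) *\<^sub>R S1 \<in> regular_part C"
      using S C by (intro regular_partI scaleR_nonneg_nonneg subspace_scale[OF C]) auto
    then show ?thesis
      by (simp add: S scaleR_diff_right)
  qed
qed

lemma regular_part_subset: "subspace C \<Longrightarrow> regular_part C \<subseteq> C"
  by (auto simp: regular_part_def subspace_diff)

lemma subalgebra_regular_part:
  assumes C: "subspace C" and comp: "\<And>S T. S \<in> C \<Longrightarrow> T \<in> C \<Longrightarrow> S o\<^sub>L T \<in> C"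
  shows "subalgebra_of (regular_part C) regular_ops"
  unfolding subalgebra_of_def
proof (intro conjI ballI)
  show "regular_part C \<subseteq> regular_ops"
    by (auto simp: regular_ops_def regular_part_def)
  show "subspace (regular_part C)"
    using C by (rule subspace_regular_part)
  fix S T
  assume "S \<in> regular_part C" "T \<in> regular_part C"
  then obtain S1 S2 T1 T2 where S: "S = S1 - S2" "0 \<le> S1" "S1 \<in> C" "0 \<le> S2" "S2 \<in> C"
    and T: "T = T1 - T2" "0 \<le> T1" "T1 \<in> C" "0 \<le> T2" "T2 \<in> C"
    unfolding regular_part_def by blast
  \<comment> \<open>Expanding the product of the differences and grouping its terms by sign leaves
    two positive members of \<open>C\<close>.\<close>
  have "((S1 o\<^sub>L T1) + (S2 o\<^sub>L T2)) - ((S1 o\<^sub>L T2) + (S2 o\<^sub>L T1)) \<in> regular_part C"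
    using S T C comp
    by (intro regular_partI) (auto intro!: subspace_add add_nonneg_nonneg blinfun_compose_nonneg)
  also have "((S1 o\<^sub>L T1) + (S2 o\<^sub>L T2)) - ((S1 o\<^sub>L T2) + (S2 o\<^sub>L T1)) = S o\<^sub>L T"
    by (rule blinfun_eqI) (simp add: S T blinfun.bilinear_simps)
  finally show "S o\<^sub>L T \<in> regular_part C" .
qed

text \<open>The identity is positive, hence regular, so equality puts it into \<open>C\<close>. The
  second assumption is the form in which one-sided absorption of all operators enters.\<close>

lemma regular_part_eq_regular_ops_iff:
  assumes C: "subspace C" and id: "id_blinfun \<in> C \<Longrightarrow> C = UNIV"
  shows "regular_part C = regular_ops \<longleftrightarrow> id_blinfun \<in> C"
proof
  have "id_blinfun - 0 \<in> (regular_ops :: ('a \<Rightarrow>\<^sub>L 'a) set)"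
    unfolding regular_ops_eq by (rule regular_partI) (auto simp: blinfun_nonneg_iff)
  moreover assume "regular_part C = regular_ops"
  ultimately show "id_blinfun \<in> C"
    using regular_part_subset[OF C] by auto
next
  assume "id_blinfun \<in> C"
  then show "regular_part C = regular_ops"
    using id by (simp add: regular_ops_eq)
qed

definition dominated_closed :: "('a::banach_lattice \<Rightarrow>\<^sub>L 'a) set \<Rightarrow> bool"
  where "dominated_closed C \<longleftrightarrow> (\<forall>S T. 0 \<le> S \<and> S \<le> T \<and> T \<in> C \<longrightarrow> S \<in> C)"

text \<open>For \<open>T = T1 - T2\<close> the sum \<open>T1 + T2\<close> dominates. The converse
  splits \<open>T\<close> without suprema of operators, so it is available in every Banach
  lattice.\<close>

lemma regular_part_iff_dominated:
  assumes C: "subspace C" and dom: "dominated_closed C"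
  shows "T \<in> regular_part C \<longleftrightarrow> (\<exists>S\<in>C. T \<le> S \<and> - T \<le> S)"
proof
  assume "T \<in> regular_part C"
  then obtain T1 T2 where T: "T = T1 - T2" "0 \<le> T1" "T1 \<in> C" "0 \<le> T2" "T2 \<in> C"
    unfolding regular_part_def by blast
  have "T1 + - T2 \<le> T1 + T2" "T2 + - T1 \<le> T2 + T1"
    using T by (intro add_left_mono; meson neg_le_0_iff_le order_trans)+
  then show "\<exists>S\<in>C. T \<le> S \<and> - T \<le> S"
    using T C by (intro bexI[of _ "T1 + T2"]) (auto simp: subspace_add add.commute)
next
  assume "\<exists>S\<in>C. T \<le> S \<and> - T \<le> S"
  then obtain S where S: "S \<in> C" "T \<le> S" "- T \<le> S"
    by blast
  \<comment> \<open>The halves are positive because \<open>S\<close> dominates both signs of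
    \<open>T\<close>. They sum to \<open>S\<close>, so each is below \<open>S\<close> and hence in
    \<open>C\<close>.\<close>
  define T1 where "T1 = (1 / 2) *\<^sub>R (S + T)"
  define T2 where "T2 = (1 / 2) *\<^sub>R (S - T)"
  have "0 \<le> S + T" "0 \<le> S - T"
    using S(2) add_mono[OF S(3) order_refl[of T]] by simp_all
  then have nonneg: "0 \<le> T1" "0 \<le> T2"
    unfolding T1_def T2_def by (auto intro: scaleR_nonneg_nonneg)
  have "S + T + (S - T) = S + S" "S + T - (S - T) = T + T"
    by simp_all
  then have "T1 + T2 = (1 / 2) *\<^sub>R (S + S)" "T1 - T2 = (1 / 2) *\<^sub>R (T + T)"
    by (simp_all only: T1_def T2_def flip: scaleR_add_right scaleR_diff_right)
  then have sum: "T1 + T2 = S" and diff: "T = T1 - T2"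
    by (simp_all only: scaleR_half_double)
  have "T1 + 0 \<le> T1 + T2" "0 + T2 \<le> T1 + T2"
    using nonneg by (intro add_left_mono add_right_mono; simp)+
  then have "T1 \<le> S" "T2 \<le> S"
    by (simp_all add: sum)
  then have "T1 \<in> C" "T2 \<in> C"
    using dom nonneg S(1) unfolding dominated_closed_def by blast+
  then show "T \<in> regular_part C"
    unfolding diff using nonneg by (auto intro: regular_partI)
qed

lemma regular_ops_iff_dominated: "T \<in> regular_ops \<longleftrightarrow> (\<exists>S. T \<le> S \<and> - T \<le> S)"
  unfolding regular_ops_eq
  by (subst regular_part_iff_dominated) (auto simp: dominated_closed_def)

lemma subspace_regular_ops: "subspace regular_ops"
  unfolding regular_ops_eq by (rule subspace_regular_part) simp

lemma nonneg_regular: "0 \<le> T \<Longrightarrow> T \<in> regular_ops"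
  unfolding regular_ops_eq using regular_partI[of T UNIV 0] by simp

section \<open>The Banach lattice of regular operators\<close>

lemma modulus_in_regular_ops:
  fixes T :: "'a::banach_lattice \<Rightarrow>\<^sub>L 'a"
  assumes dc: "dedekind_complete TYPE('a)" and T: "T \<in> regular_ops"
  shows le_modulus: "T \<le> modulus_in regular_ops T"
    and minus_le_modulus: "- T \<le> modulus_in regular_ops T"
    and modulus_le: "\<And>S. T \<le> S \<Longrightarrow> - T \<le> S \<Longrightarrow> modulus_in regular_ops T \<le> S"
proof -
  obtain S where S: "T \<le> S" "- T \<le> S"
    using T regular_ops_iff_dominated by blast
  have SS: "T + T \<le> S + S" "0 \<le> S + S"
    using S nonneg_of_minus_le[OF S] by (auto intro: add_mono)
  obtain P where P: "0 \<le> P" "T + T \<le> P" "\<And>U. 0 \<le> U \<Longrightarrow> T + T \<le> U \<Longrightarrow> P \<le> U"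
    using positive_part_exists[OF dc SS] by metis
  \<comment> \<open>This is the lattice identity \<open>\<bar>T\<bar> = (2T)^+ - T\<close>, with
    \<open>P\<close> the positive part of \<open>T + T\<close>.\<close>
  define M where "M = P - T"
  have M: "T \<le> M" "- T \<le> M"
    using P(1,2) by (simp_all add: M_def le_diff_eq)
  have M_le: "M \<le> U" if "T \<le> U" "- T \<le> U" for U
  proof -
    have "0 \<le> U + T" "T + T \<le> U + T"
      using that(1) add_mono[OF that(2) order_refl[of T]] by simp_all
    then have "P \<le> U + T"
      by (rule P(3))
    then show ?thesis
      by (simp add: M_def diff_le_eq)
  qed
  have "M \<in> regular_ops"
    using nonneg_of_minus_le[OF M] by (rule nonneg_regular)
  then have sup: "sup_in regular_ops {T, - T} M"
    using M M_le by (simp add: sup_in_def)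
  have "modulus_in regular_ops T = M"
    unfolding modulus_in_def
  proof (rule the_equality)
    show "sup_in regular_ops {T, - T} M"
      by (rule sup)
    fix m
    assume "sup_in regular_ops {T, - T} m"
    with sup show "m = M"
      unfolding sup_in_def by (intro antisym) auto
  qed
  then show "T \<le> modulus_in regular_ops T" "- T \<le> modulus_in regular_ops T"
    "\<And>S. T \<le> S \<Longrightarrow> - T \<le> S \<Longrightarrow> modulus_in regular_ops T \<le> S"
    using M M_le by auto
qed

lemma regular_norm_le:
  assumes "T \<le> S" "- T \<le> S"
  shows "regular_norm T \<le> norm S"
  unfolding regular_norm_def using assms by (intro cInf_lower bdd_belowI[where m = 0]) auto

text \<open>The modulus is one of the dominating operators and lies below all others, and the
  operator norm is monotone on positive operators; thus the infimum is attained.\<close>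

lemma regular_norm_eq:
  fixes T :: "'a::banach_lattice \<Rightarrow>\<^sub>L 'a"
  assumes dc: "dedekind_complete TYPE('a)" and T: "T \<in> regular_ops"
  shows "regular_norm T = norm (modulus_in regular_ops T)"
proof (rule antisym)
  note m = modulus_in_regular_ops[OF dc T]
  show "regular_norm T \<le> norm (modulus_in regular_ops T)"
    using m by (intro regular_norm_le)
  show "norm (modulus_in regular_ops T) \<le> regular_norm T"
    unfolding regular_norm_def
  proof (rule cInf_greatest)
    show "{norm S | S. T \<le> S \<and> - T \<le> S} \<noteq> {}"
      using m by blast
    fix c
    assume "c \<in> {norm S | S. T \<le> S \<and> - T \<le> S}"
    then obtain S where S: "c = norm S" "T \<le> S" "- T \<le> S"
      by blast
    have "modulus_in regular_ops T \<le> S"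
      using m S by blast
    moreover have "- modulus_in regular_ops T \<le> modulus_in regular_ops T"
      using nonneg_of_minus_le[OF m(1,2)] by (meson neg_le_0_iff_le order_trans)
    ultimately show "norm (modulus_in regular_ops T) \<le> c"
      unfolding S(1) by (intro norm_blinfun_le_of_dominated) auto
  qed
qed

lemma regular_norm_attained:
  fixes T :: "'a::banach_lattice \<Rightarrow>\<^sub>L 'a"
  assumes dc: "dedekind_complete TYPE('a)" and T: "T \<in> regular_ops"
  obtains S where "T \<le> S" "- T \<le> S" "norm S = regular_norm T"
  using modulus_in_regular_ops(1,2)[OF dc T] regular_norm_eq[OF dc T, symmetric] by (rule that)

lemma norm_le_regular_norm:
  fixes T :: "'a::banach_lattice \<Rightarrow>\<^sub>L 'a"
  assumes dc: "dedekind_complete TYPE('a)" and T: "T \<in> regular_ops"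
  shows "norm T \<le> regular_norm T"
proof -
  obtain S where "T \<le> S" "- T \<le> S" "norm S = regular_norm T"
    using assms by (rule regular_norm_attained)
  then show ?thesis
    using norm_blinfun_le_of_dominated[of T S] by simp
qed

lemma regular_norm_zero: "regular_norm 0 = 0"
proof (rule antisym)
  show "regular_norm 0 \<le> 0"
    using regular_norm_le[of 0 0] by simp
  show "0 \<le> regular_norm 0"
    unfolding regular_norm_def by (rule cInf_greatest) auto
qed

lemma regular_norm_triangle:
  fixes S T :: "'a::banach_lattice \<Rightarrow>\<^sub>L 'a"
  assumes dc: "dedekind_complete TYPE('a)" and ST: "S \<in> regular_ops" "T \<in> regular_ops"
  shows "regular_norm (S + T) \<le> regular_norm S + regular_norm T"
proof -
  obtain A where A: "S \<le> A" "- S \<le> A" "norm A = regular_norm S"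
    using dc ST(1) by (rule regular_norm_attained)
  obtain B where B: "T \<le> B" "- T \<le> B" "norm B = regular_norm T"
    using dc ST(2) by (rule regular_norm_attained)
  have "regular_norm (S + T) \<le> norm (A + B)"
    using A B add_mono[of "- S" A "- T" B] by (intro regular_norm_le) (auto intro: add_mono)
  then show ?thesis
    using norm_triangle_ineq[of A B] A B by simp
qed

lemma regular_norm_scaleR:
  fixes T :: "'a::banach_lattice \<Rightarrow>\<^sub>L 'a"
  assumes dc: "dedekind_complete TYPE('a)" and T: "T \<in> regular_ops"
  shows "regular_norm (c *\<^sub>R T) = \<bar>c\<bar> * regular_norm T"
proof -
  have le: "regular_norm (d *\<^sub>R U) \<le> \<bar>d\<bar> * regular_norm U" if U: "U \<in> regular_ops"
    for d and U :: "'a \<Rightarrow>\<^sub>L 'a"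
  proof -
    obtain A where A: "U \<le> A" "- U \<le> A" "norm A = regular_norm U"
      using regular_norm_attained[OF dc U] .
    have "\<bar>d\<bar> *\<^sub>R U \<le> \<bar>d\<bar> *\<^sub>R A" "\<bar>d\<bar> *\<^sub>R (- U) \<le> \<bar>d\<bar> *\<^sub>R A"
      using A by (intro scaleR_left_mono; simp)+
    then have "regular_norm (d *\<^sub>R U) \<le> norm (\<bar>d\<bar> *\<^sub>R A)"
      by (intro regular_norm_le) (cases "0 \<le> d"; simp)+
    then show ?thesis
      using A by simp
  qed
  show ?thesis
  proof (cases "c = 0")
    case True
    then show ?thesis
      by (simp add: regular_norm_zero)
  next
    case False
    have "c *\<^sub>R T \<in> regular_ops"
      by (rule subspace_scale[OF subspace_regular_ops T])
    from le[OF this, of "inverse c"] have "\<bar>c\<bar> * regular_norm T \<le> regular_norm (c *\<^sub>R T)"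
      using False by (simp add: field_simps)
    with le[OF T, of c] show ?thesis
      by simp
  qed
qed

lemma regular_norm_minus:
  "regular_norm (- T) = regular_norm T"
  by (simp add: regular_norm_def conj_commute)

text \<open>The operator norm is at most the regular norm and supplies a limit \<open>x\<close>.
  Convergence in the regular norm needs operators dominating \<open>x - X (r k)\<close>: along a
  rapidly Cauchy subsequence the differences are dominated by \<open>D k\<close> of geometric size,
  and the tails \<open>U k\<close> of the series of the \<open>D k\<close> do it.\<close>

lemma regular_norm_complete:
  fixes X :: "nat \<Rightarrow> 'a::banach_lattice \<Rightarrow>\<^sub>L 'a"
  assumes dc: "dedekind_complete TYPE('a)" and X: "\<And>n. X n \<in> regular_ops"
    and cauchy: "\<And>e. e > 0 \<Longrightarrow> \<exists>M. \<forall>m\<ge>M. \<forall>n\<ge>M. regular_norm (X m - X n) < e"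
  obtains x where "x \<in> regular_ops" "(\<lambda>n. regular_norm (X n - x)) \<longlonglongrightarrow> 0"
proof -
  have diff: "X m - X n \<in> regular_ops" for m n
    by (intro subspace_diff subspace_regular_ops X)
  have "Cauchy X"
  proof (rule CauchyI)
    fix e :: real
    assume "0 < e"
    then obtain M where "\<forall>m\<ge>M. \<forall>n\<ge>M. regular_norm (X m - X n) < e"
      using cauchy by blast
    then show "\<exists>M. \<forall>m\<ge>M. \<forall>n\<ge>M. norm (X m - X n) < e"
      using norm_le_regular_norm[OF dc diff] by (blast intro: le_less_trans)
  qed
  then obtain x where x: "X \<longlonglongrightarrow> x"
    using Cauchy_convergent convergent_def by blast
  have "\<exists>M. \<forall>m\<ge>M. \<forall>n\<ge>M. regular_norm (X m - X n) < (1 / 2) ^ k" for k :: nat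
    by (rule cauchy) simp
  then obtain M where M: "\<And>k m n. m \<ge> M k \<Longrightarrow> n \<ge> M k \<Longrightarrow> regular_norm (X m - X n) < (1 / 2) ^ k"
    by metis
  \<comment> \<open>The sum puts both \<open>r k\<close> and \<open>r (Suc k)\<close> beyond
    \<open>M k\<close>; the added \<open>k\<close> sends \<open>r\<close> to infinity.\<close>
  define r where "r k = (\<Sum>j\<le>k. M j) + k" for k
  have r_ge: "M k \<le> r k" "M k \<le> r (Suc k)" for k
  proof -
    have "M k \<le> (\<Sum>j\<le>k. M j)"
      by (intro member_le_sum) auto
    then show "M k \<le> r k" "M k \<le> r (Suc k)"
      by (simp_all add: r_def)
  qed
  have r_filter: "filterlim r at_top sequentially"
    by (rule filterlim_at_top_mono[OF filterlim_ident]) (auto simp: r_def)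
  have "\<exists>D. X (r (Suc k)) - X (r k) \<le> D \<and> - (X (r (Suc k)) - X (r k)) \<le> D
      \<and> norm D \<le> (1 / 2) ^ k" for k
  proof -
    obtain S where "X (r (Suc k)) - X (r k) \<le> S" "- (X (r (Suc k)) - X (r k)) \<le> S"
        "norm S = regular_norm (X (r (Suc k)) - X (r k))"
      using dc diff by (rule regular_norm_attained)
    moreover have "regular_norm (X (r (Suc k)) - X (r k)) < (1 / 2) ^ k"
      using r_ge(2,1) by (rule M)
    ultimately show ?thesis
      by (intro exI[of _ S]) simp
  qed
  then obtain D where D: "\<And>k. X (r (Suc k)) - X (r k) \<le> D k"
      "\<And>k. - (X (r (Suc k)) - X (r k)) \<le> D k" "\<And>k. norm (D k) \<le> (1 / 2) ^ k"
    by metis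
  define U where "U k = (\<Sum>j. D (j + k))" for k
  have geom: "(\<lambda>j. (1 / 2) ^ (j + k)) sums (2 * (1 / 2) ^ k :: real)" for k
    using sums_mult2[OF geometric_sums[of "1 / 2 :: real"], of "(1 / 2) ^ k"] by (simp add: power_add)
  have sum_norm: "summable (\<lambda>j. norm (D (j + k)))" for k
    by (rule summable_comparison_test'[OF sums_summable[OF geom[of k]]]) (simp add: D(3))
  have U_lim: "(\<lambda>n. \<Sum>j<n. D (j + k)) \<longlonglongrightarrow> U k" for k
    unfolding U_def by (intro summable_LIMSEQ summable_norm_cancel[OF sum_norm])
  have norm_U: "norm (U k) \<le> 2 * (1 / 2) ^ k" for k
  proof -
    have "norm (U k) \<le> (\<Sum>j. norm (D (j + k)))"
      unfolding U_def by (rule summable_norm[OF sum_norm])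
    also have "\<dots> \<le> (\<Sum>j. (1 / 2) ^ (j + k))"
      by (intro suminf_le sum_norm sums_summable[OF geom] D(3))
    also have "\<dots> = 2 * (1 / 2) ^ k"
      using geom by (simp add: sums_iff)
    finally show ?thesis .
  qed
  \<comment> \<open>Telescoping compares differences with partial sums of \<open>D\<close>; the
    inequality survives the limit because the positive cone is closed.\<close>
  have tele: "X (r (n + k)) - X (r k) = (\<Sum>j<n. X (r (Suc (j + k))) - X (r (j + k)))" for n k
    using sum_lessThan_telescope[of "\<lambda>j. X (r (j + k))" n] by simp
  have lim: "(\<lambda>n. X (r (n + k)) - X (r k)) \<longlonglongrightarrow> x - X (r k)" for k
    by (intro tendsto_diff tendsto_const LIMSEQ_ignore_initial_segment filterlim_compose[OF x r_filter])
  have upper: "x - X (r k) \<le> U k" for k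
    by (rule blinfun_le_limit[OF lim U_lim]) (simp add: tele sum_mono D(1))
  have "- (x - X (r k)) \<le> U k" for k
  proof (rule blinfun_le_limit[OF tendsto_minus[OF lim] U_lim])
    show "- (X (r (n + k)) - X (r k)) \<le> (\<Sum>j<n. D (j + k))" for n
      unfolding tele sum_negf[symmetric] by (intro sum_mono D(2))
  qed
  note dominated = upper this
  have near: "regular_norm (x - X (r k)) \<le> 2 * (1 / 2) ^ k" for k
    using regular_norm_le[OF dominated[of k]] norm_U[of k] by simp
  have tail_regular: "x - X (r k) \<in> regular_ops" for k
    using dominated regular_ops_iff_dominated by blast
  then have x_regular: "x \<in> regular_ops"
    using subspace_add[OF subspace_regular_ops tail_regular[of 0] X[of "r 0"]] by simp
  have "(\<lambda>n. regular_norm (X n - x)) \<longlonglongrightarrow> 0"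
  proof (rule LIMSEQ_I)
    fix e :: real
    assume e: "0 < e"
    \<comment> \<open>One \<open>(1 / 2) ^ k\<close> will come from the Cauchy estimate and two from
      \<open>near\<close>, hence the third of \<open>e\<close>.\<close>
    obtain k where k: "(1 / 2) ^ k < e / 3"
      using real_arch_pow_inv[of "e / 3" "1 / 2"] e by auto
    have "norm (regular_norm (X n - x) - 0) < e" if n: "n \<ge> M k" for n
    proof -
      have "X n - x = (X n - X (r k)) + - (x - X (r k))"
        by simp
      also have "regular_norm \<dots> \<le> regular_norm (X n - X (r k)) + regular_norm (- (x - X (r k)))"
        by (intro regular_norm_triangle[OF dc] diff tail_regular
            subspace_neg[OF subspace_regular_ops])
      also have "\<dots> \<le> (1 / 2) ^ k + 2 * (1 / 2) ^ k"
        unfolding regular_norm_minus using M[OF n r_ge(1)] near[of k] by (intro add_mono) auto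
      finally have "regular_norm (X n - x) < e"
        using k by simp
      moreover have "0 \<le> regular_norm (X n - x)"
        using norm_le_regular_norm[OF dc subspace_diff[OF subspace_regular_ops X x_regular]]
          norm_ge_zero by (rule order_trans[rotated])
      ultimately show ?thesis
        by simp
    qed
    then show "\<exists>N. \<forall>n\<ge>N. norm (regular_norm (X n - x) - 0) < e"
      by blast
  qed
  then show ?thesis
    using that x_regular by blast
qed

text \<open>Translation by \<open>T\<close> reduces the supremum to a positive part: it is
  \<open>(S - T)^+ + T\<close>.\<close>

lemma sup_in_regular_ops_exists:
  fixes S T :: "'a::banach_lattice \<Rightarrow>\<^sub>L 'a"
  assumes dc: "dedekind_complete TYPE('a)" and ST: "S \<in> regular_ops" "T \<in> regular_ops"
  shows "\<exists>U. sup_in regular_ops {S, T} U"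
proof -
  have "S - T \<in> regular_ops"
    by (intro subspace_diff subspace_regular_ops ST)
  then obtain B where B: "S - T \<le> B" "- (S - T) \<le> B"
    using regular_ops_iff_dominated by blast
  obtain P where P: "0 \<le> P" "S - T \<le> P" "\<And>U. 0 \<le> U \<Longrightarrow> S - T \<le> U \<Longrightarrow> P \<le> U"
    using positive_part_exists[OF dc B(1) nonneg_of_minus_le[OF B]] by metis
  have "P \<le> U - T" if "S \<le> U" "T \<le> U" for U
    using that by (intro P(3)) (auto intro: diff_right_mono)
  then have "P + T \<le> U" if "S \<le> U" "T \<le> U" for U
    using that by (simp add: le_diff_eq)
  moreover have "P + T \<in> regular_ops"
    by (intro subspace_add subspace_regular_ops nonneg_regular P(1) ST(2))
  ultimately have "sup_in regular_ops {S, T} (P + T)"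
    using P by (auto simp: sup_in_def diff_le_eq)
  then show ?thesis
    by blast
qed

lemma banach_lattice_on_regular_ops:
  assumes dc: "dedekind_complete TYPE('a::banach_lattice)"
  shows "banach_lattice_on (regular_ops :: ('a \<Rightarrow>\<^sub>L 'a) set) regular_norm"
  unfolding banach_lattice_on_def
proof (intro conjI ballI allI impI)
  fix S T :: "'a \<Rightarrow>\<^sub>L 'a"
  assume S: "S \<in> regular_ops"
  have le: "norm S \<le> regular_norm S"
    by (rule norm_le_regular_norm[OF dc S])
  show "0 \<le> regular_norm S"
    using norm_ge_zero le by (rule order_trans)
  show "regular_norm S = 0 \<longleftrightarrow> S = 0"
    using le by (auto simp: regular_norm_zero)
  show "regular_norm (c *\<^sub>R S) = \<bar>c\<bar> * regular_norm S" for c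
    by (rule regular_norm_scaleR[OF dc S])
  assume T: "T \<in> regular_ops"
  show "\<exists>U. sup_in regular_ops {S, T} U"
    by (rule sup_in_regular_ops_exists[OF dc S T])
  show "regular_norm (S + T) \<le> regular_norm S + regular_norm T"
    by (rule regular_norm_triangle[OF dc S T])
  assume "modulus_in regular_ops S \<le> modulus_in regular_ops T"
  then have "regular_norm S \<le> norm (modulus_in regular_ops T)"
    using modulus_in_regular_ops(1,2)[OF dc S] by (intro regular_norm_le) auto
  then show "regular_norm S \<le> regular_norm T"
    by (simp add: regular_norm_eq[OF dc T])
next
  fix X :: "nat \<Rightarrow> 'a \<Rightarrow>\<^sub>L 'a"
  assume X: "range X \<subseteq> regular_ops \<and>
    (\<forall>e>0. \<exists>M. \<forall>m\<ge>M. \<forall>n\<ge>M. regular_norm (X m - X n) < e)"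
  obtain x where "x \<in> regular_ops" "(\<lambda>n. regular_norm (X n - x)) \<longlonglongrightarrow> 0"
    by (rule regular_norm_complete[OF dc, of X]) (use X in auto)
  then show "\<exists>x\<in>regular_ops. (\<lambda>n. regular_norm (X n - x)) \<longlonglongrightarrow> 0"
    by blast
qed (rule subspace_regular_ops)

lemma closed_order_ideal_regular_part:
  fixes C :: "('a::banach_lattice \<Rightarrow>\<^sub>L 'a) set"
  assumes dc: "dedekind_complete TYPE('a)"
    and C: "subspace C" "closed C" "dominated_closed C"
  shows "closed_order_ideal regular_ops regular_norm (regular_part C)"
  unfolding closed_order_ideal_def order_ideal_in_def closed_wrt_def
proof (intro conjI ballI allI impI)
  note iff = regular_part_iff_dominated[OF C(1,3)]
  note mod = modulus_in_regular_ops[OF dc]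
  show sub: "regular_part C \<subseteq> regular_ops"
    by (auto simp: regular_ops_def regular_part_def)
  show "subspace (regular_part C)"
    by (rule subspace_regular_part[OF C(1)])
  have mod_mem: "modulus_in regular_ops T \<in> C" if T: "T \<in> regular_part C" for T
  proof -
    have reg: "T \<in> regular_ops"
      using T sub by blast
    obtain S where "S \<in> C" "T \<le> S" "- T \<le> S"
      using T iff by blast
    then show ?thesis
      using mod(3)[OF reg] nonneg_of_minus_le[OF mod(1)[OF reg] mod(2)[OF reg]] C(3)
      unfolding dominated_closed_def by blast
  qed
  show "S \<in> regular_part C" if S: "S \<in> regular_ops" and T: "T \<in> regular_part C"
    and le: "modulus_in regular_ops S \<le> modulus_in regular_ops T" for S T
    using mod(1,2)[OF S] le mod_mem[OF T] iff by (blast intro: order_trans)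
  fix X :: "nat \<Rightarrow> 'a \<Rightarrow>\<^sub>L 'a" and x
  assume x: "x \<in> regular_ops"
    and X: "range X \<subseteq> regular_part C \<and> (\<lambda>n. regular_norm (X n - x)) \<longlonglongrightarrow> 0"
  have Xr: "X n \<in> regular_ops" for n
    using X sub by blast
  have close: "norm (modulus_in regular_ops (X n) - modulus_in regular_ops x)
      \<le> regular_norm (X n - x)" for n
  proof -
    obtain D where D: "X n - x \<le> D" "- (X n - x) \<le> D" "norm D = regular_norm (X n - x)"
      using regular_norm_attained[OF dc subspace_diff[OF subspace_regular_ops Xr x]] .
    \<comment> \<open>Half of the reverse triangle inequality. Used in both orders of
      \<open>X n\<close> and \<open>x\<close>, it bounds the difference of the moduli by
      \<open>D\<close>, whose norm is \<open>regular_norm (X n - x)\<close>.\<close>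
    have le: "modulus_in regular_ops S \<le> modulus_in regular_ops T + D"
      if "S \<in> regular_ops" "T \<in> regular_ops" "S - T \<le> D" "- (S - T) \<le> D" for S T
    proof (rule mod(3)[OF that(1)])
      have "T + (S - T) \<le> modulus_in regular_ops T + D"
        using mod(1)[OF that(2)] that(3) by (rule add_mono)
      then show "S \<le> modulus_in regular_ops T + D"
        by simp
      have "- T + - (S - T) \<le> modulus_in regular_ops T + D"
        using mod(2)[OF that(2)] that(4) by (rule add_mono)
      then show "- S \<le> modulus_in regular_ops T + D"
        by simp
    qed
    have "modulus_in regular_ops (X n) - modulus_in regular_ops x \<le> D"
      "- (modulus_in regular_ops (X n) - modulus_in regular_ops x) \<le> D"
      using le[OF Xr x D(1,2)] le[OF x Xr, of n] D(1,2) by (simp_all add: diff_le_eq add.commute)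
    then show ?thesis
      using norm_blinfun_le_of_dominated D(3) by metis
  qed
  have "(\<lambda>n. regular_norm (X n - x)) \<longlonglongrightarrow> 0"
    using X by blast
  then have "(\<lambda>n. modulus_in regular_ops (X n) - modulus_in regular_ops x) \<longlonglongrightarrow> 0"
    by (rule Lim_null_comparison[rotated]) (simp add: close)
  then have "(\<lambda>n. modulus_in regular_ops (X n)) \<longlonglongrightarrow> modulus_in regular_ops x"
    by (rule LIM_zero_cancel)
  moreover have "modulus_in regular_ops (X n) \<in> C" for n
    using X by (intro mod_mem) auto
  ultimately have "modulus_in regular_ops x \<in> C"
    by (rule closed_sequentially[OF C(2), rotated])
  then show "x \<in> regular_part C"
    using mod(1,2)[OF x] iff by blast
qed

section \<open>The classes l-Lwc and l-Mwc\<close>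

lemma subspace_l_Lwc: "subspace l_Lwc"
proof (rule subspaceI)
  show "0 \<in> l_Lwc"
    by (simp add: l_Lwc_iff Lwc_set_singleton_0)
  show "S + T \<in> l_Lwc" if "S \<in> l_Lwc" "T \<in> l_Lwc" for S T
    using that unfolding l_Lwc_iff by (simp add: blinfun.add_left Lwc_set_singleton_add)
  show "c *\<^sub>R T \<in> l_Lwc" if "T \<in> l_Lwc" for c T
    using that unfolding l_Lwc_iff by (simp add: blinfun.scaleR_left Lwc_set_singleton_scaleR)
qed

lemma closed_l_Lwc: "closed (l_Lwc :: ('a::banach_lattice \<Rightarrow>\<^sub>L 'a) set)"
  unfolding closed_sequential_limits
proof safe
  fix X :: "nat \<Rightarrow> 'a \<Rightarrow>\<^sub>L 'a" and T
  assume X: "\<forall>n. X n \<in> l_Lwc" "X \<longlonglongrightarrow> T"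
  have "Lwc_set {T x}" for x
  proof (rule Lwc_set_singleton_approx)
    fix e :: real
    assume "0 < e"
    have "(\<lambda>n. X n x) \<longlonglongrightarrow> T x"
      using X(2) by (intro tendsto_intros)
    then have "\<exists>N. \<forall>n\<ge>N. norm (X n x - T x) < e"
      using \<open>0 < e\<close> by (rule LIMSEQ_D)
    then obtain n where n: "norm (X n x - T x) < e"
      by blast
    \<comment> \<open>The left side is \<open>\<bar>T x\<bar>\<close>, here bounded by a point of
      the order continuous part and a small error.\<close>
    have "\<bar>X n x - (X n x - T x)\<bar> \<le> \<bar>X n x\<bar> + \<bar>X n x - T x\<bar>"
      by (rule abs_triangle_ineq4)
    then show "\<exists>y w. Lwc_set {y} \<and> \<bar>T x\<bar> \<le> \<bar>y\<bar> + \<bar>w\<bar> \<and> norm w < e"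
      using X(1) n by (intro exI[of _ "X n x"] exI[of _ "X n x - T x"]) (simp add: l_Lwc_iff)
  qed
  then show "T \<in> l_Lwc"
    by (simp add: l_Lwc_iff)
qed

text \<open>Domination gives \<open>\<bar>S x\<bar> \<le> T \<bar>x\<bar>\<close>. The criterion
  runs over all points, so it may be applied to \<open>T\<close> at \<open>\<bar>x\<bar>\<close>;
  nothing has to be known about the moduli of a limited set.\<close>

lemma dominated_closed_l_Lwc: "dominated_closed l_Lwc"
  unfolding dominated_closed_def
proof safe
  fix S T :: "'a \<Rightarrow>\<^sub>L 'a"
  assume ST: "0 \<le> S" "S \<le> T" "T \<in> l_Lwc"
  have "\<bar>S x\<bar> \<le> \<bar>T \<bar>x\<bar>\<bar>" for x
  proof -
    have "- S \<le> T"
      using ST by (meson neg_le_0_iff_le order_trans)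
    then have "\<bar>S x\<bar> \<le> T \<bar>x\<bar>"
      using ST by (intro abs_blinfun_apply_le)
    also have "\<dots> \<le> \<bar>T \<bar>x\<bar>\<bar>"
      by (rule abs_ge_self)
    finally show ?thesis .
  qed
  then show "S \<in> l_Lwc"
    using ST(3) Lwc_set_singleton_mono unfolding l_Lwc_iff by blast
qed

text \<open>The points \<open>T x\<close> are among those at which the criterion for
  \<open>S\<close> holds.\<close>

lemma l_Lwc_compose: "S \<in> l_Lwc \<Longrightarrow> S o\<^sub>L T \<in> l_Lwc"
  by (simp add: l_Lwc_iff)

section \<open>The class l-Mwc: linearity, closedness, domination and absorption\<close>

lemma subspace_l_Mwc: "subspace l_Mwc"
proof (rule subspaceI)
  show "0 \<in> l_Mwc"
    by (simp add: l_Mwc_def weakly_null_def)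
  show "S + T \<in> l_Mwc" if "S \<in> l_Mwc" "T \<in> l_Mwc" for S T
    using that unfolding l_Mwc_def weakly_null_def
    by (auto simp: blinfun.bilinear_simps intro!: tendsto_add_zero)
  show "c *\<^sub>R T \<in> l_Mwc" if "T \<in> l_Mwc" for c T
    using that unfolding l_Mwc_def weakly_null_def
    by (auto simp: blinfun.bilinear_simps intro!: tendsto_mult_right_zero)
qed

lemma closed_l_Mwc: "closed (l_Mwc :: ('a::banach_lattice \<Rightarrow>\<^sub>L 'a) set)"
  unfolding closed_sequential_limits
proof safe
  fix X :: "nat \<Rightarrow> 'a \<Rightarrow>\<^sub>L 'a" and T
  assume X: "\<forall>n. X n \<in> l_Mwc" "X \<longlonglongrightarrow> T"
  show "T \<in> l_Mwc"
    unfolding l_Mwc_def weakly_null_def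
  proof safe
    fix x :: "nat \<Rightarrow> 'a" and f :: "'a \<Rightarrow>\<^sub>L real"
    assume x: "disjoint_seq x" "bounded (range x)"
    obtain B where B: "0 < B" "\<And>n. norm (x n) \<le> B"
      using x(2) unfolding bounded_pos by auto
    show "(\<lambda>n. f (T (x n))) \<longlonglongrightarrow> 0"
    proof (rule LIMSEQ_I)
      fix e :: real
      assume e: "0 < e"
      \<comment> \<open>Chosen so that \<open>(norm f + 1) * (d * B) = e / 2\<close>; the added 1
        keeps the denominator positive when \<open>f = 0\<close>.\<close>
      define d where "d = e / 2 / ((norm f + 1) * B)"
      have pos: "0 < (norm f + 1) * B"
        using B by (intro mult_pos_pos add_nonneg_pos) auto
      then have "0 < d"
        using e by (simp add: d_def)
      with X(2) have "\<exists>K. \<forall>k\<ge>K. norm (X k - T) < d"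
        by (rule LIMSEQ_D)
      then obtain k where k: "norm (X k - T) < d"
        by blast
      have "(\<lambda>n. f (X k (x n))) \<longlonglongrightarrow> 0"
        using X(1) x unfolding l_Mwc_def weakly_null_def by blast
      then have "\<exists>N. \<forall>n\<ge>N. norm (f (X k (x n)) - 0) < e / 2"
        by (rule LIMSEQ_D) (use e in simp)
      then obtain N where N: "\<And>n. n \<ge> N \<Longrightarrow> norm (f (X k (x n))) < e / 2"
        by auto
      have "norm (f (T (x n)) - 0) < e" if "n \<ge> N" for n
      proof -
        have "norm (f ((X k - T) (x n))) \<le> norm f * norm ((X k - T) (x n))"
          by (rule norm_blinfun)
        also have "\<dots> \<le> norm f * (norm (X k - T) * norm (x n))"
          by (intro mult_left_mono norm_blinfun) simp
        also have "\<dots> \<le> (norm f + 1) * (d * B)"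
          using k B \<open>0 < d\<close> by (intro mult_mono) auto
        also have "\<dots> = e / 2"
          using pos by (simp add: d_def field_simps)
        finally have "norm (f (X k (x n)) - f (T (x n))) \<le> e / 2"
          by (simp add: blinfun.bilinear_simps)
        moreover have "norm (f (X k (x n))) < e / 2"
          using N that by blast
        ultimately show ?thesis
          unfolding real_norm_def by linarith
      qed
      then show "\<exists>N. \<forall>n\<ge>N. norm (f (T (x n)) - 0) < e"
        by blast
    qed
  qed
qed

text \<open>With a positive \<open>h\<close> above \<open>f\<close> and \<open>- f\<close> one has
  \<open>\<bar>f (S y)\<bar> \<le> h (T \<bar>y\<bar>)\<close>, and the moduli of a disjoint bounded
  sequence are again disjoint and bounded.\<close>

lemma dominated_closed_l_Mwc: "dominated_closed l_Mwc"
  unfolding dominated_closed_def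
proof safe
  fix S T :: "'a \<Rightarrow>\<^sub>L 'a"
  assume ST: "0 \<le> S" "S \<le> T" "T \<in> l_Mwc"
  show "S \<in> l_Mwc"
    unfolding l_Mwc_def weakly_null_def
  proof safe
    fix x :: "nat \<Rightarrow> 'a" and f :: "'a \<Rightarrow>\<^sub>L real"
    assume x: "disjoint_seq x" "bounded (range x)"
    obtain h where h: "f \<le> h" "- f \<le> h"
      by (rule functional_dominated)
    have h_nonneg: "0 \<le> h"
      using h by (rule nonneg_of_minus_le)
    have "- S \<le> T"
      using ST by (meson neg_le_0_iff_le order_trans)
    then have S_le: "\<bar>S y\<bar> \<le> T \<bar>y\<bar>" for y
      using ST by (intro abs_blinfun_apply_le)
    have f_le: "norm (f (S y)) \<le> h (T \<bar>y\<bar>)" for y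
    proof -
      have "\<bar>f (S y)\<bar> \<le> h \<bar>S y\<bar>"
        using h by (rule abs_blinfun_apply_le)
      also have "0 \<le> h (T \<bar>y\<bar> - \<bar>S y\<bar>)"
        using h_nonneg S_le[of y] by (simp add: blinfun_nonneg_iff)
      then have "h \<bar>S y\<bar> \<le> h (T \<bar>y\<bar>)"
        by (simp add: blinfun.diff_right)
      finally show ?thesis
        by simp
    qed
    have "disjoint_seq (\<lambda>n. \<bar>x n\<bar>)"
      using x(1) by (rule disjoint_seq_mono) simp
    moreover have "bounded (range (\<lambda>n. \<bar>x n\<bar>))"
      using x(2) by (simp add: bounded_iff)
    ultimately have "(\<lambda>n. h (T \<bar>x n\<bar>)) \<longlonglongrightarrow> 0"
      using ST(3) unfolding l_Mwc_def weakly_null_def by blast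
    then show "(\<lambda>n. f (S (x n))) \<longlonglongrightarrow> 0"
      by (rule Lim_null_comparison[rotated]) (simp only: f_le eventually_True)
  qed
qed

text \<open>A bounded functional composed with \<open>S\<close> is another test functional for
  \<open>T\<close>; so absorption is on the side opposite to l-Lwc.\<close>

lemma blinfun_compose_l_Mwc:
  assumes "T \<in> l_Mwc"
  shows "S o\<^sub>L T \<in> l_Mwc"
  unfolding l_Mwc_def weakly_null_def
proof safe
  fix x :: "nat \<Rightarrow> 'a" and f :: "'a \<Rightarrow>\<^sub>L real"
  assume "disjoint_seq x" "bounded (range x)"
  then have "(\<lambda>n. (f o\<^sub>L S) (T (x n))) \<longlonglongrightarrow> 0"
    using assms unfolding l_Mwc_def weakly_null_def by blast
  then show "(\<lambda>n. f ((S o\<^sub>L T) (x n))) \<longlonglongrightarrow> 0"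
    by simp
qed

lemma r_l_Lwc_eq: "r_l_Lwc = regular_part l_Lwc"
  by (simp add: r_l_Lwc_def regular_part_def)

lemma r_l_Mwc_eq: "r_l_Mwc = regular_part l_Mwc"
  by (simp add: r_l_Mwc_def regular_part_def)

lemma blinfun_compose_id [simp]: "id_blinfun o\<^sub>L T = T" "T o\<^sub>L id_blinfun = T"
  by (rule blinfun_eqI; simp)+

theorem theorem3p7:
  shows
   "(subalgebra_of (r_l_Lwc :: ('a::banach_lattice \<Rightarrow>\<^sub>L 'a) set) regular_ops \<and>
     subalgebra_of (r_l_Mwc :: ('a \<Rightarrow>\<^sub>L 'a) set) regular_ops \<and>
     ((r_l_Lwc :: ('a \<Rightarrow>\<^sub>L 'a) set) = regular_ops \<longleftrightarrow> (id_blinfun :: 'a \<Rightarrow>\<^sub>L 'a) \<in> l_Lwc) \<and>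
     ((r_l_Mwc :: ('a \<Rightarrow>\<^sub>L 'a) set) = regular_ops \<longleftrightarrow> (id_blinfun :: 'a \<Rightarrow>\<^sub>L 'a) \<in> l_Mwc)) \<and>
    (dedekind_complete TYPE('a) \<longrightarrow>
     banach_lattice_on (regular_ops :: ('a \<Rightarrow>\<^sub>L 'a) set) regular_norm \<and>
     closed_order_ideal regular_ops regular_norm (r_l_Lwc :: ('a \<Rightarrow>\<^sub>L 'a) set) \<and>
     closed_order_ideal regular_ops regular_norm (r_l_Mwc :: ('a \<Rightarrow>\<^sub>L 'a) set))"
  unfolding r_l_Lwc_eq r_l_Mwc_eq
proof (intro conjI impI)
  show "subalgebra_of (regular_part l_Lwc :: ('a \<Rightarrow>\<^sub>L 'a) set) regular_ops"
    by (intro subalgebra_regular_part subspace_l_Lwc l_Lwc_compose)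
  show "subalgebra_of (regular_part l_Mwc :: ('a \<Rightarrow>\<^sub>L 'a) set) regular_ops"
    by (intro subalgebra_regular_part subspace_l_Mwc blinfun_compose_l_Mwc)
  show "(regular_part l_Lwc :: ('a \<Rightarrow>\<^sub>L 'a) set) = regular_ops \<longleftrightarrow> (id_blinfun :: 'a \<Rightarrow>\<^sub>L 'a) \<in> l_Lwc"
    \<comment> \<open>Once the identity is in the class, so is every
      \<open>id_blinfun o\<^sub>L T = T\<close>.\<close>
    using l_Lwc_compose[of id_blinfun]
    by (intro regular_part_eq_regular_ops_iff subspace_l_Lwc) auto
  show "(regular_part l_Mwc :: ('a \<Rightarrow>\<^sub>L 'a) set) = regular_ops \<longleftrightarrow> (id_blinfun :: 'a \<Rightarrow>\<^sub>L 'a) \<in> l_Mwc"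
    \<comment> \<open>Here the identity is the right factor, as in
      \<open>S o\<^sub>L id_blinfun = S\<close>.\<close>
    using blinfun_compose_l_Mwc[of id_blinfun]
    by (intro regular_part_eq_regular_ops_iff subspace_l_Mwc) auto
  assume dc: "dedekind_complete TYPE('a)"
  show "banach_lattice_on (regular_ops :: ('a \<Rightarrow>\<^sub>L 'a) set) regular_norm"
    by (rule banach_lattice_on_regular_ops[OF dc])
  show "closed_order_ideal regular_ops regular_norm (regular_part l_Lwc :: ('a \<Rightarrow>\<^sub>L 'a) set)"
    by (rule closed_order_ideal_regular_part[OF dc subspace_l_Lwc closed_l_Lwc dominated_closed_l_Lwc])
  show "closed_order_ideal regular_ops regular_norm (regular_part l_Mwc :: ('a \<Rightarrow>\<^sub>L 'a) set)"
    by (rule closed_order_ideal_regular_part[OF dc subspace_l_Mwc closed_l_Mwc dominated_closed_l_Mwc])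
qed

end
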